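(* Let $\mathbf A$ be a regular BBL transformation with matrix Laurent polynomial $A(w,w^{-1})$ of bandwidth $(p,q)$, and write $\det A(w,w^{-1})=c\,w^{dp}\prod_{\ell=0}^n(w-z_\ell)^{s_\ell}$ with $c\neq0$, $z_0=0$ ($s_0=0$ if $0$ is not a root) and $z_1,\dots,z_n$ the distinct nonzero roots with multiplicities $s_\ell$. Then: (i) $\ker\mathbf A=\bigoplus_{\ell=1}^n\big(\ker\mathbf A\cap\mathcal T_{z_\ell,s_\ell}\big)$, and under the isomorphism $\mathbb C^{ds}\ni(u_1,\dots,u_s)\mapsto\sum_{v=1}^s\Phi_{z,v}u_v\in\mathcal T_{z,s}$, $\ker\mathbf A\cap\mathcal T_{z_\ell,s_\ell}$ corresponds to $\ker A_{s_\ell}(z_\ell)$; in particular $\ker\mathbf A$ is finite-dimensional; (ii) for every $\ell=1,\dots,n$, $\dim\ker A(z_\ell,z_\ell^{-1})\le\dim\ker A_{s_\ell}(z_\ell)=s_\ell$. Moreover, if equality $\dim\ker A(z_\ell,z_\ell^{-1})=s_\ell$ holds in (ii), then $\ker\mathbf A\cap\mathcal T_{z_\ell,s_\ell}=\operatorname{Span}\{\Phi_{z_\ell,1}u_s\}_{s=1}^{s_\ell}$, where $\{u_s\}_{s=1}^{s_\ell}$ is any basis of $\ker A(z_\ell,z_\ell^{-1})$.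
   Context: Fix $d\ge1$. $\mathcal V^S_d$: doubly infinite sequences $\{\psi_j\}_{j\in\mathbb Z}$, $\psi_j\in\mathbb C^d$; $\mathbf T$ the left shift $(\mathbf T\Psi)_j=\psi_{j+1}$. A matrix Laurent polynomial of bandwidth $(p,q)$ is $A(w,w^{-1})=\sum_{r=p}^qa_rw^r$, $a_r$ complex $d\times d$ matrices, $a_p\ne0\ne a_q$; its BBL transformation is $(\mathbf A\Psi)_j=\sum_ra_r\psi_{j+r}$. $\mathbf A$ is regular if $\det(w^{-p}A(w,w^{-1}))$ is not the zero polynomial. For $z\ne0$, $v\ge1$: $\Phi_{z,v}=\{j^{(v-1)}z^{j-v+1}\}_{j\in\mathbb Z}$ with $j^{(0)}=1$, $j^{(k)}=j(j-1)\cdots(j-k+1)$; $\Phi u=\{\phi_ju\}$ for $u\in\mathbb C^d$; $\mathcal T_{z,s}=\operatorname{Span}\{\Phi_{z,v}e_m: 1\le v\le s,1\le m\le d\}$ ($e_m$ standard basis). $A_s(z)$ is the $s\times s$ block matrix with $d\times d$ blocks $[A_s(z)]_{xv}=\binom{v-1}{x-1}A^{(v-x)}(z,z^{-1})$ for $x\le v$ and $0$ for $x>v$, $A^{(k)}$ the $k$-th $z$-derivative of $z\mapsto\sum_ra_rz^r$; it is the matrix of $\mathbf A|_{\mathcal T_{z,s}}$ in the basis $\{\Phi_{z,v}e_m\}$. *)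

theory Defs
  imports "Jordan_Normal_Form.Matrix_Kernel" "HOL-Library.Function_Algebras"
    "HOL-Computational_Algebra.Polynomial" Complex_Main
begin

text \<open>Sequences in V^S_d are modelled as functions int => nat => complex, where
  psi j m is the m-th component (0-based, m < d) of psi_j; components m >= d are 0.
  Matrices are d x d Jordan_Normal_Form matrices; a matrix Laurent polynomial of
  bandwidth (p,q) is given by its coefficients a r, r in {p..q}.\<close>

definition seq_space :: "nat \<Rightarrow> (int \<Rightarrow> nat \<Rightarrow> complex) set" where
  "seq_space d = {\<psi>. \<forall>j m. d \<le> m \<longrightarrow> \<psi> j m = 0}"

definition seq_scale :: "complex \<Rightarrow> (int \<Rightarrow> nat \<Rightarrow> complex) \<Rightarrow> (int \<Rightarrow> nat \<Rightarrow> complex)" where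
  "seq_scale c \<psi> = (\<lambda>j m. c * \<psi> j m)"

abbreviation seq_span :: "(int \<Rightarrow> nat \<Rightarrow> complex) set \<Rightarrow> (int \<Rightarrow> nat \<Rightarrow> complex) set" where
  "seq_span S \<equiv> Modules.module.span seq_scale S"

definition laurent_bw :: "nat \<Rightarrow> (int \<Rightarrow> complex mat) \<Rightarrow> int \<Rightarrow> int \<Rightarrow> bool" where
  "laurent_bw d a p q \<longleftrightarrow> p \<le> q \<and> (\<forall>r\<in>{p..q}. a r \<in> carrier_mat d d)
     \<and> a p \<noteq> 0\<^sub>m d d \<and> a q \<noteq> 0\<^sub>m d d"

definition bbl :: "nat \<Rightarrow> (int \<Rightarrow> complex mat) \<Rightarrow> int \<Rightarrow> int \<Rightarrow>
    (int \<Rightarrow> nat \<Rightarrow> complex) \<Rightarrow> (int \<Rightarrow> nat \<Rightarrow> complex)" where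
  "bbl d a p q \<psi> = (\<lambda>j i. if i < d then (\<Sum>r\<in>{p..q}. \<Sum>k<d. a r $$ (i, k) * \<psi> (j + r) k) else 0)"

definition bbl_kernel :: "nat \<Rightarrow> (int \<Rightarrow> complex mat) \<Rightarrow> int \<Rightarrow> int \<Rightarrow> (int \<Rightarrow> nat \<Rightarrow> complex) set" where
  "bbl_kernel d a p q = {\<psi> \<in> seq_space d. bbl d a p q \<psi> = 0}"

text \<open>The polynomial matrix w^{-p} A(w,w^{-1}) and its determinant.\<close>
definition symbol_poly_mat :: "nat \<Rightarrow> (int \<Rightarrow> complex mat) \<Rightarrow> int \<Rightarrow> int \<Rightarrow> complex poly mat" where
  "symbol_poly_mat d a p q = mat d d (\<lambda>(i, k). \<Sum>r\<in>{p..q}. monom (a r $$ (i, k)) (nat (r - p)))"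

definition regular_bbl :: "nat \<Rightarrow> (int \<Rightarrow> complex mat) \<Rightarrow> int \<Rightarrow> int \<Rightarrow> bool" where
  "regular_bbl d a p q \<longleftrightarrow> det (symbol_poly_mat d a p q) \<noteq> 0"

definition ffact_int :: "int \<Rightarrow> nat \<Rightarrow> complex" where
  "ffact_int j k = (\<Prod>i<k. of_int (j - int i))"

definition symbol_deriv :: "nat \<Rightarrow> (int \<Rightarrow> complex mat) \<Rightarrow> int \<Rightarrow> int \<Rightarrow> nat \<Rightarrow> complex \<Rightarrow> complex mat" where
  "symbol_deriv d a p q k z = mat d d (\<lambda>(i, m). \<Sum>r\<in>{p..q}. ffact_int r k * z powi (r - int k) * a r $$ (i, m))"

abbreviation symbol_eval :: "nat \<Rightarrow> (int \<Rightarrow> complex mat) \<Rightarrow> int \<Rightarrow> int \<Rightarrow> complex \<Rightarrow> complex mat" where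
  "symbol_eval d a p q z \<equiv> symbol_deriv d a p q 0 z"

text \<open>The block matrix A_s(z) (ds x ds); block (x,v) (1-based) is
  binom(v-1,x-1) A^(v-x)(z) for x <= v, 0 otherwise.  Here blocks are 0-based.\<close>
definition block_symbol :: "nat \<Rightarrow> (int \<Rightarrow> complex mat) \<Rightarrow> int \<Rightarrow> int \<Rightarrow> nat \<Rightarrow> complex \<Rightarrow> complex mat" where
  "block_symbol d a p q s z = mat (d * s) (d * s) (\<lambda>(i, k).
     (let x = i div d; v = k div d in
       if x \<le> v then of_nat (v choose x) * symbol_deriv d a p q (v - x) z $$ (i mod d, k mod d)
       else 0))"

definition Phi :: "complex \<Rightarrow> nat \<Rightarrow> int \<Rightarrow> complex" where
  "Phi z v j = ffact_int j (v - 1) * z powi (j - int v + 1)"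

definition Phi_vec :: "nat \<Rightarrow> complex \<Rightarrow> nat \<Rightarrow> complex vec \<Rightarrow> (int \<Rightarrow> nat \<Rightarrow> complex)" where
  "Phi_vec d z v u = (\<lambda>j m. if m < d then Phi z v j * u $ m else 0)"

definition T_space :: "nat \<Rightarrow> complex \<Rightarrow> nat \<Rightarrow> (int \<Rightarrow> nat \<Rightarrow> complex) set" where
  "T_space d z s = seq_span {(\<lambda>j m. if m = e then Phi z v j else 0) | v e. 1 \<le> v \<and> v \<le> s \<and> e < d}"

definition T_embed :: "nat \<Rightarrow> complex \<Rightarrow> nat \<Rightarrow> complex vec \<Rightarrow> (int \<Rightarrow> nat \<Rightarrow> complex)" where
  "T_embed d z s x = (\<lambda>j m. if m < d then (\<Sum>v\<in>{1..s}. Phi z v j * x $ ((v - 1) * d + m)) else 0)"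

text \<open>W is the internal direct sum of the subspaces S i, i in I (I finite).\<close>
definition internal_direct_sum :: "'b::ab_group_add set \<Rightarrow> 'a set \<Rightarrow> ('a \<Rightarrow> 'b set) \<Rightarrow> bool" where
  "internal_direct_sum W I S \<longleftrightarrow>
     W = {(\<Sum>i\<in>I. f i) | f. \<forall>i\<in>I. f i \<in> S i} \<and>
     (\<forall>f. (\<forall>i\<in>I. f i \<in> S i) \<longrightarrow> (\<Sum>i\<in>I. f i) = 0 \<longrightarrow> (\<forall>i\<in>I. f i = 0))"

end

theory Submission
  imports Defs "HOL-Computational_Algebra.Fundamental_Theorem_Algebra"
    "HOL-Computational_Algebra.Formal_Power_Series"
begin

text \<open>
  Let \<open>M(w) = w\<^bsup>-p\<^esup> A(w)\<close> and \<open>P = det M\<close>; up to a shift the transformation is \<open>M(T)\<close>, where \<open>T\<close> is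
  the left shift. Since \<open>adj M * M = P\<close>, every element of the kernel is annihilated by \<open>P(T)\<close>, and
  Bezout's identity splits it into pieces annihilated by \<open>(T - z)\<^sup>s\<close>, \<open>z\<close> running over the nonzero
  roots of \<open>P\<close> and \<open>s\<close> being the order of \<open>z\<close>; the root \<open>0\<close> contributes nothing because \<open>T\<close> is
  injective. The space \<open>T_space d z s\<close> is exactly the kernel of \<open>(T - z)\<^sup>s\<close>.

  For the dimension, fix \<open>z\<close> and let everything act on the generalized eigenspace of \<open>T\<close> at \<open>z\<close>. If
  \<open>P(z) = 0\<close>, pick \<open>u\<close> with \<open>M(z) u = 0\<close> and \<open>u\<^sub>k = 1\<close>. Then \<open>M = B E\<close>, where \<open>E\<close> is the identity
  matrix except for column \<open>k\<close>, which has \<open>w - z\<close> on the diagonal and \<open>-u\<^sub>i\<close> elsewhere. The operator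
  \<open>E(T)\<close> is onto with kernel spanned by \<open>\<Phi>\<^bsub>z,1\<^esub> u\<close>, and \<open>det E = w - z\<close>, so induction on the order of
  vanishing of \<open>det M\<close> at \<open>z\<close> shows that this order is the dimension of the kernel of \<open>M(T)\<close>.
\<close>

section \<open>Polynomials in the shift acting on scalar sequences\<close>

text \<open>The operator p(T), where T is the left shift.\<close>

definition shift_poly :: "complex poly \<Rightarrow> (int \<Rightarrow> complex) \<Rightarrow> int \<Rightarrow> complex" where
  "shift_poly p f = (\<lambda>j. \<Sum>i\<le>degree p. coeff p i * f (j + int i))"

lemma shift_poly_bound:
  assumes "degree p \<le> n"
  shows "shift_poly p f j = (\<Sum>i\<le>n. coeff p i * f (j + int i))"
  unfolding shift_poly_def
  by (rule sum.mono_neutral_left) (use assms in \<open>auto simp: coeff_eq_0\<close>)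

lemma shift_poly_0 [simp]: "shift_poly 0 f = (\<lambda>j. 0)"
  by (simp add: shift_poly_def)

lemma shift_poly_pCons:
  "shift_poly (pCons c p) f = (\<lambda>j. c * f j + shift_poly p (\<lambda>j. f (j + 1)) j)"
proof
  fix j
  have "degree (pCons c p) \<le> Suc (degree p)"
    by (simp add: degree_pCons_le)
  from shift_poly_bound[OF this]
  have "shift_poly (pCons c p) f j = (\<Sum>i\<le>Suc (degree p). coeff (pCons c p) i * f (j + int i))" .
  also have "\<dots> = c * f j + (\<Sum>i\<le>degree p. coeff p i * f (j + 1 + int i))"
    by (subst sum.atMost_Suc_shift) (simp add: algebra_simps)
  finally show "shift_poly (pCons c p) f j = c * f j + shift_poly p (\<lambda>j. f (j + 1)) j"
    by (simp add: shift_poly_def algebra_simps)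
qed

lemma shift_poly_1 [simp]: "shift_poly 1 f = f"
  by (simp add: shift_poly_def)

lemma shift_poly_linear_factor: "shift_poly [:-z, 1:] f = (\<lambda>j. f (j + 1) - z * f j)"
  by (simp add: shift_poly_def)

lemma shift_poly_add: "shift_poly (p + q) f = (\<lambda>j. shift_poly p f j + shift_poly q f j)"
proof
  fix j
  have "degree (p + q) \<le> max (degree p) (degree q)"
    by (rule degree_add_le_max)
  then show "shift_poly (p + q) f j = shift_poly p f j + shift_poly q f j"
    by (simp add: shift_poly_bound[where n = "max (degree p) (degree q)"] distrib_right
        sum.distrib)
qed

lemma shift_poly_smult: "shift_poly (smult c p) f = (\<lambda>j. c * shift_poly p f j)"
proof
  fix j
  show "shift_poly (smult c p) f j = c * shift_poly p f j"
    using shift_poly_bound[OF degree_smult_le, of c p f j]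
    by (simp add: shift_poly_def sum_distrib_left algebra_simps)
qed

lemma shift_poly_poly_sum:
  "shift_poly (\<Sum>i\<in>I. p i) f = (\<lambda>j. \<Sum>i\<in>I. shift_poly (p i) f j)"
  by (induction I rule: infinite_finite_induct) (simp_all add: shift_poly_add)

lemma shift_poly_monom: "shift_poly (monom c n) f = (\<lambda>j. c * f (j + int n))"
proof
  fix j
  have "shift_poly (monom c n) f j = (\<Sum>i\<le>n. coeff (monom c n) i * f (j + int i))"
    by (rule shift_poly_bound) (rule degree_monom_le)
  also have "\<dots> = (\<Sum>i\<in>{n}. coeff (monom c n) i * f (j + int i))"
    by (rule sum.mono_neutral_right) auto
  finally show "shift_poly (monom c n) f j = c * f (j + int n)"
    by simp
qed

lemma shift_poly_add_right:
  "shift_poly p (\<lambda>j. f j + g j) = (\<lambda>j. shift_poly p f j + shift_poly p g j)"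
  by (simp add: shift_poly_def algebra_simps sum.distrib)

lemma shift_poly_scale_right: "shift_poly p (\<lambda>j. c * f j) = (\<lambda>j. c * shift_poly p f j)"
  by (simp add: shift_poly_def mult.left_commute sum_distrib_left)

lemma shift_poly_zero_right [simp]: "shift_poly p (\<lambda>j. 0) = (\<lambda>j. 0)"
  by (simp add: shift_poly_def)

lemma shift_poly_sum_right:
  "shift_poly p (\<lambda>j. \<Sum>i\<in>I. f i j) = (\<lambda>j. \<Sum>i\<in>I. shift_poly p (f i) j)"
  by (induction I rule: infinite_finite_induct) (simp_all add: shift_poly_add_right)

lemma shift_poly_translate: "shift_poly p (\<lambda>j. f (j + 1)) = (\<lambda>j. shift_poly p f (j + 1))"
  by (simp add: shift_poly_def algebra_simps)

text \<open>With \<open>pCons c p\<close> read as c + w p, the inductive step only needs that T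
  commutes with polynomials in T.\<close>

lemma shift_poly_mult: "shift_poly (p * q) f = shift_poly p (shift_poly q f)"
proof (induction p arbitrary: f)
  case 0
  then show ?case by simp
next
  case (pCons c p)
  then show ?case
    by (simp add: shift_poly_add shift_poly_smult shift_poly_pCons shift_poly_translate)
qed

lemma shift_poly_commute: "shift_poly p (shift_poly q f) = shift_poly q (shift_poly p f)"
  unfolding shift_poly_mult[symmetric] by (simp only: mult.commute)

section \<open>The first-order operator T - z and the sequences \<open>Phi z v\<close>\<close>

text \<open>Variation of constants: putting f_j = z^j h_j turns (T - z) f = g into h_{j+1} - h_j =
  g_j z^{-j-1}, which is solved by summation.\<close>

lemma linear_factor_surj:
  assumes "z \<noteq> 0"
  shows "\<exists>f. shift_poly [:-z, 1:] f = g"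
proof -
  define u where "u i = g i * z powi (- i - 1)" for i
  \<comment> \<open>The discrete integral of \<open>u\<close> from 0 to \<open>j\<close>. One of the
    two sums is always empty, so the formula serves both signs of \<open>j\<close>.\<close>
  define h where "h j = sum u {0..<j} - sum u {j..<0}" for j :: int
  have step: "h (j + 1) = h j + u j" for j
  proof (cases "0 \<le> j")
    case True
    then have "{0..<j + 1} = insert j {0..<j}" by auto
    with True show ?thesis by (simp add: h_def)
  next
    case False
    then have "{j..<0} = insert j {j + 1..<0}" by auto
    with False show ?thesis by (simp add: h_def)
  qed
  have "z powi (j + 1) * u j = g j" for j
    using assms by (simp add: u_def flip: power_int_add)
  then have "shift_poly [:-z, 1:] (\<lambda>j. z powi j * h j) = g"
    using assms by (auto simp: shift_poly_linear_factor step fun_eq_iff algebra_simps power_int_add)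
  then show ?thesis by blast
qed

lemma Phi_1: "Phi z (Suc 0) j = z powi j"
  by (simp add: Phi_def ffact_int_def)

text \<open>The quotient f_j / z^j is invariant under the shift, hence constant in both directions
  from 0.\<close>

lemma linear_factor_kernel:
  assumes "z \<noteq> 0" "shift_poly [:-z, 1:] f = (\<lambda>j. 0)"
  shows "f = (\<lambda>j. f 0 * Phi z 1 j)"
proof -
  define h where "h j = f j * z powi (- j)" for j
  have step: "h (j + 1) = h j" for j
    using assms by (simp add: h_def shift_poly_linear_factor fun_eq_iff power_int_diff)
  have "h j = h 0" for j
  proof (induction j rule: int_induct[where k = 0])
    case (step2 i)
    then show ?case using step[of "i - 1"] by simp
  qed (simp_all add: step)
  then have "f j = f 0 * z powi j" for j
    using assms(1) by (metis h_def minus_zero mult.right_neutral nonzero_divide_eq_eq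
        power_int_0_right power_int_minus_divide power_int_not_zero times_divide_eq_right)
  then show ?thesis unfolding One_nat_def Phi_1 by (rule ext)
qed

lemma ffact_int_Suc: "ffact_int j (Suc k) = ffact_int j k * of_int (j - int k)"
  by (simp add: ffact_int_def)

lemma ffact_int_shift: "ffact_int (j + 1) (Suc k) = of_int (j + 1) * ffact_int j k"
  unfolding ffact_int_def by (subst prod.lessThan_Suc_shift) simp

text \<open>Since \<open>Phi z (Suc v) j\<close> is the v-th z-derivative of z^j, T - z acts as a
  lowering operator. The factor comes from (j+1)^{(v+1)} - j^{(v+1)} = (v+1) j^{(v)} for falling
  factorials.\<close>

lemma linear_factor_Phi:
  assumes "z \<noteq> 0"
  shows "shift_poly [:-z, 1:] (Phi z (Suc (Suc v))) = (\<lambda>j. of_nat (Suc v) * Phi z (Suc v) j)"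
    and "shift_poly [:-z, 1:] (Phi z (Suc 0)) = (\<lambda>j. 0)"
proof -
  show "shift_poly [:-z, 1:] (Phi z (Suc (Suc v))) = (\<lambda>j. of_nat (Suc v) * Phi z (Suc v) j)"
  proof
    fix j
    have "z powi (j - int v) = z * z powi (j - int (Suc v))"
      using assms power_int_add[of z 1 "j - int (Suc v)"] by simp
    then show "shift_poly [:-z, 1:] (Phi z (Suc (Suc v))) j = of_nat (Suc v) * Phi z (Suc v) j"
      unfolding shift_poly_linear_factor Phi_def diff_Suc_1
      unfolding ffact_int_shift ffact_int_Suc[of j v]
      by (simp add: algebra_simps)
  qed
  show "shift_poly [:-z, 1:] (Phi z (Suc 0)) = (\<lambda>j. 0)"
    using assms by (simp add: shift_poly_linear_factor Phi_1 power_int_add)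
qed

text \<open>Induction on \<open>s\<close> through the lowering property: the image of
  \<open>f\<close> under T - z is a combination of the first \<open>s\<close> sequences, and
  integrating it leaves only a multiple of \<open>Phi z 1\<close> undetermined.\<close>

lemma Phi_kernel_iff:
  assumes "z \<noteq> 0"
  shows "shift_poly ([:-z, 1:] ^ s) f = (\<lambda>j. 0) \<longleftrightarrow>
    (\<exists>c. f = (\<lambda>j. \<Sum>v\<in>{1..s}. c v * Phi z v j))"
proof (induction s arbitrary: f)
  case 0
  then show ?case by (simp add: fun_eq_iff)
next
  case (Suc s)
  have split: "(\<Sum>v\<in>{1..Suc s}. g v) = g 1 + (\<Sum>v\<in>{1..s}. g (Suc v))" for g :: "nat \<Rightarrow> complex"
    using sum.atLeast_Suc_atMost_Suc_shift[of g 1 s]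
    by (subst sum.atLeast_Suc_atMost) auto
  have lin: "shift_poly [:-z, 1:] (Phi z (Suc v)) j = of_nat v * Phi z v j" if "v \<in> {1..s}" for v j
    using that linear_factor_Phi(1)[OF assms, of "v - 1"] by (cases v) (auto)
  have app: "shift_poly [:-z, 1:] (\<lambda>j. \<Sum>v\<in>{1..s}. c v * Phi z (Suc v) j) =
      (\<lambda>j. \<Sum>v\<in>{1..s}. c v * of_nat v * Phi z v j)" for c
    by (auto simp: shift_poly_sum_right shift_poly_scale_right lin mult.assoc)
  show ?case
  proof
    assume "shift_poly ([:-z, 1:] ^ Suc s) f = (\<lambda>j. 0)"
    then have "shift_poly ([:-z, 1:] ^ s) (shift_poly [:-z, 1:] f) = (\<lambda>j. 0)"
      by (metis shift_poly_mult power_Suc2)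
    then obtain c where c: "shift_poly [:-z, 1:] f = (\<lambda>j. \<Sum>v\<in>{1..s}. c v * Phi z v j)"
      using Suc.IH by blast
    \<comment> \<open>A preimage under T - z: the division by \<open>v\<close> compensates the
      factor with which \<open>Phi z (Suc v)\<close> is lowered to \<open>Phi z v\<close>.\<close>
    define g where "g = (\<lambda>j. \<Sum>v\<in>{1..s}. (c v / of_nat v) * Phi z (Suc v) j)"
    have "shift_poly [:-z, 1:] (\<lambda>j. f j + (-1) * g j) = (\<lambda>j. 0)"
      unfolding shift_poly_add_right shift_poly_scale_right unfolding g_def app
      by (simp add: c)
    from linear_factor_kernel[OF assms this]
    obtain k where "(\<lambda>j. f j + (-1) * g j) = (\<lambda>j. k * Phi z 1 j)" by blast
    then have "f j = k * Phi z 1 j + g j" for j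
      by (simp add: fun_eq_iff algebra_simps)
    then have "f = (\<lambda>j. \<Sum>v\<in>{1..Suc s}. (if v = 1 then k else c (v - 1) / of_nat (v - 1)) * Phi z v j)"
      unfolding split by (auto simp: g_def intro!: sum.cong)
    then show "\<exists>c. f = (\<lambda>j. \<Sum>v\<in>{1..Suc s}. c v * Phi z v j)"
      by (rule exI[of _ "\<lambda>v. if v = 1 then k else c (v - 1) / of_nat (v - 1)"])
  next
    assume "\<exists>c. f = (\<lambda>j. \<Sum>v\<in>{1..Suc s}. c v * Phi z v j)"
    then obtain c where f: "f = (\<lambda>j. \<Sum>v\<in>{1..Suc s}. c v * Phi z v j)" by blast
    have "shift_poly [:-z, 1:] f = (\<lambda>j. \<Sum>v\<in>{1..s}. (c (Suc v) * of_nat v) * Phi z v j)"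
      unfolding f split shift_poly_add_right shift_poly_scale_right app
      using linear_factor_Phi(2)[OF assms] by simp
    then have "shift_poly ([:-z, 1:] ^ s) (shift_poly [:-z, 1:] f) = (\<lambda>j. 0)"
      by (subst Suc.IH) (rule exI[of _ "\<lambda>v. c (Suc v) * of_nat v"])
    then show "shift_poly ([:-z, 1:] ^ Suc s) f = (\<lambda>j. 0)"
      by (metis shift_poly_mult power_Suc2)
  qed
qed

text \<open>At \<open>j = n\<close> the terms with \<open>v > n + 1\<close> vanish, so the system is triangular.\<close>
lemma Phi_independent:
  assumes "\<And>j. (\<Sum>v\<in>{1..s}. c v * Phi z v j) = 0" and "v \<in> {1..s}"
  shows "c v = 0"
  using assms(2)
proof (induction v rule: less_induct)
  case (less v)
  have Phi_0: "Phi z w (int v - 1) = 0" if "w > v" for w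
  proof -
    have "ffact_int (int v - 1) (w - 1) = 0"
      unfolding ffact_int_def
      by (rule prod_zero) (use that less.prems in \<open>auto intro!: bexI[of _ "v - 1"] simp: of_nat_diff\<close>)
    then show ?thesis by (simp add: Phi_def)
  qed
  have "Phi z v (int v - 1) \<noteq> 0"
  proof -
    have "int v - 1 - int i \<noteq> 0" if "i < v - 1" for i
      using that by linarith
    then have "ffact_int (int v - 1) (v - 1) \<noteq> 0"
      unfolding ffact_int_def by (simp only: prod_zero_iff finite_lessThan of_int_eq_0_iff) auto
    then show ?thesis by (simp add: Phi_def)
  qed
  moreover have "(\<Sum>w\<in>{1..s}. c w * Phi z w (int v - 1)) = (\<Sum>w\<in>{v}. c w * Phi z w (int v - 1))"
  proof (rule sum.mono_neutral_right)
    show "\<forall>i\<in>{1..s} - {v}. c i * Phi z i (int v - 1) = 0"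
    proof
      fix i assume i: "i \<in> {1..s} - {v}"
      show "c i * Phi z i (int v - 1) = 0"
        using less.IH[of i] Phi_0[of i] i by (cases "i < v") auto
    qed
  qed (use less.prems in auto)
  ultimately show ?case using assms(1)[of "int v - 1"] by simp
qed

text \<open>The Leibniz rule for the k-th z-derivative of z^{j+r} = z^j z^r; algebraically it is
  Vandermonde's identity for falling factorials. It is the origin of the binomial coefficients in
  \<open>block_symbol\<close>.\<close>

lemma Phi_Leibniz:
  assumes "z \<noteq> 0"
  shows "Phi z (Suc k) (j + r) = (\<Sum>x\<le>k. of_nat (k choose x) * Phi z (Suc x) j *
    (ffact_int r (k - x) * z powi (r - int (k - x))))"
proof -
  have ffact: "ffact_int i n = fact n * (of_int i gchoose n)" for i n
    by (simp add: ffact_int_def gbinomial_mult_fact atLeast0LessThan)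
  have "ffact_int (j + r) k =
      fact k * (\<Sum>x\<le>k. (of_int j gchoose x) * (of_int r gchoose (k - x)))"
    unfolding ffact by (simp add: gbinomial_Vandermonde atMost_atLeast0)
  also have "\<dots> = (\<Sum>x\<le>k. of_nat (k choose x) * ffact_int j x * ffact_int r (k - x))"
    unfolding sum_distrib_left ffact
    by (rule sum.cong) (auto simp: binomial_fact)
  finally have V: "ffact_int (j + r) k = \<dots>" .
  have "z powi (j + r - int k) = z powi (j - int x) * z powi (r - int (k - x))" if "x \<le> k" for x
    using assms that by (simp add: of_nat_diff diff_add_eq add_diff_eq flip: power_int_add)
  note pow = this
  have "Phi z (Suc k) (j + r) = ffact_int (j + r) k * z powi (j + r - int k)"
    by (simp add: Phi_def add_diff_eq)
  also have "\<dots> = (\<Sum>x\<le>k. of_nat (k choose x) * Phi z (Suc x) j *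
    (ffact_int r (k - x) * z powi (r - int (k - x))))"
    unfolding V sum_distrib_right by (rule sum.cong) (auto simp: pow Phi_def)
  finally show ?thesis .
qed

section \<open>Matrix polynomials in the shift\<close>

interpretation seq: vector_space seq_scale
  by unfold_locales (auto simp: seq_scale_def fun_eq_iff algebra_simps)

lemma sum_seq_apply: "(\<Sum>i\<in>I. f i) j m = (\<Sum>i\<in>I. f i j m)"
  for f :: "'a \<Rightarrow> int \<Rightarrow> nat \<Rightarrow> complex"
  by (induction I rule: infinite_finite_induct) simp_all

definition shift_poly_seq :: "complex poly \<Rightarrow> (int \<Rightarrow> nat \<Rightarrow> complex) \<Rightarrow> int \<Rightarrow> nat \<Rightarrow> complex" where
  "shift_poly_seq p \<psi> = (\<lambda>j m. shift_poly p (\<lambda>j. \<psi> j m) j)"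

text \<open>The operator M(T) of a polynomial matrix M; \<open>shift_poly_seq p\<close> is p(T) in
  every component.\<close>

definition mat_shift ::
    "nat \<Rightarrow> complex poly mat \<Rightarrow> (int \<Rightarrow> nat \<Rightarrow> complex) \<Rightarrow> int \<Rightarrow> nat \<Rightarrow> complex" where
  "mat_shift d M \<psi> =
    (\<lambda>j i. if i < d then (\<Sum>k<d. shift_poly (M $$ (i, k)) (\<lambda>j. \<psi> j k) j) else 0)"

lemma shift_poly_seq_1 [simp]: "shift_poly_seq 1 \<psi> = \<psi>"
  by (simp add: shift_poly_seq_def)

lemma shift_poly_seq_poly_add:
  "shift_poly_seq (p + q) \<psi> = shift_poly_seq p \<psi> + shift_poly_seq q \<psi>"
  by (simp add: shift_poly_seq_def shift_poly_add fun_eq_iff)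

lemma shift_poly_seq_mult: "shift_poly_seq (p * q) \<psi> = shift_poly_seq p (shift_poly_seq q \<psi>)"
  by (simp add: shift_poly_seq_def shift_poly_mult)

lemma shift_poly_seq_smult: "shift_poly_seq (smult c p) \<psi> = seq_scale c (shift_poly_seq p \<psi>)"
  by (simp add: shift_poly_seq_def seq_scale_def shift_poly_smult)

lemma shift_poly_seq_zero [simp]: "shift_poly_seq p 0 = 0"
  by (simp add: shift_poly_seq_def fun_eq_iff)

lemma shift_poly_seq_add: "shift_poly_seq p (\<psi> + \<phi>) = shift_poly_seq p \<psi> + shift_poly_seq p \<phi>"
  by (simp add: shift_poly_seq_def shift_poly_add_right fun_eq_iff)

lemma shift_poly_seq_scale: "shift_poly_seq p (seq_scale c \<psi>) = seq_scale c (shift_poly_seq p \<psi>)"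
  by (simp add: shift_poly_seq_def seq_scale_def shift_poly_scale_right)

lemma shift_poly_seq_sum: "shift_poly_seq p (\<Sum>i\<in>I. f i) = (\<Sum>i\<in>I. shift_poly_seq p (f i))"
  by (induction I rule: infinite_finite_induct)
    (simp_all only: sum.infinite sum.empty sum.insert shift_poly_seq_add shift_poly_seq_zero
      not_False_eq_True)

lemma shift_poly_seq_dvd:
  assumes "p dvd q" "shift_poly_seq p \<psi> = 0"
  shows "shift_poly_seq q \<psi> = 0"
  using assms by (metis dvdE mult.commute shift_poly_seq_mult shift_poly_seq_zero)

lemma shift_poly_seq_in_seq_space:
  "\<psi> \<in> seq_space d \<Longrightarrow> shift_poly_seq p \<psi> \<in> seq_space d"
  by (simp add: seq_space_def shift_poly_seq_def)

lemma subspace_seq_space: "seq.subspace (seq_space d)"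
  by (auto simp: seq.subspace_def seq_space_def seq_scale_def)

lemma subspace_shift_poly_kernel: "seq.subspace {\<psi> \<in> seq_space d. shift_poly_seq p \<psi> = 0}"
  using subspace_seq_space[of d]
  by (auto simp: seq.subspace_def shift_poly_seq_add shift_poly_seq_scale)

lemma mat_shift_zero [simp]: "mat_shift d M 0 = 0"
  by (simp add: mat_shift_def fun_eq_iff)

lemma mat_shift_add: "mat_shift d M (\<psi> + \<phi>) = mat_shift d M \<psi> + mat_shift d M \<phi>"
  by (simp add: mat_shift_def shift_poly_add_right fun_eq_iff sum.distrib)

lemma mat_shift_scale: "mat_shift d M (seq_scale c \<psi>) = seq_scale c (mat_shift d M \<psi>)"
  by (simp add: mat_shift_def seq_scale_def shift_poly_scale_right fun_eq_iff sum_distrib_left)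

lemma mat_shift_in_seq_space: "mat_shift d M \<psi> \<in> seq_space d"
  by (simp add: seq_space_def mat_shift_def)

text \<open>Makes the kernel of M(T) invariant under every p(T), so that the projections of the
  primary decomposition stay inside it.\<close>

lemma mat_shift_shift_poly_seq:
  "mat_shift d M (shift_poly_seq p \<psi>) = shift_poly_seq p (mat_shift d M \<psi>)"
proof (intro ext)
  fix j i
  show "mat_shift d M (shift_poly_seq p \<psi>) j i = shift_poly_seq p (mat_shift d M \<psi>) j i"
    by (cases "i < d")
      (simp_all add: mat_shift_def shift_poly_seq_def shift_poly_sum_right
        shift_poly_commute[of "M $$ _" p])
qed

lemma mat_shift_mult:
  assumes "M \<in> carrier_mat d d" "N \<in> carrier_mat d d"
  shows "mat_shift d (M * N) \<psi> = mat_shift d M (mat_shift d N \<psi>)"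
proof (intro ext)
  fix j i
  show "mat_shift d (M * N) \<psi> j i = mat_shift d M (mat_shift d N \<psi>) j i"
  proof (cases "i < d")
    case True
    have "mat_shift d (M * N) \<psi> j i =
        (\<Sum>k<d. \<Sum>l<d. shift_poly (M $$ (i, l)) (shift_poly (N $$ (l, k)) (\<lambda>j. \<psi> j k)) j)"
      using True assms
      by (auto simp: mat_shift_def scalar_prod_def shift_poly_poly_sum atLeast0LessThan
          shift_poly_mult intro!: sum.cong)
    also have "\<dots> =
        (\<Sum>l<d. \<Sum>k<d. shift_poly (M $$ (i, l)) (shift_poly (N $$ (l, k)) (\<lambda>j. \<psi> j k)) j)"
      by (rule sum.swap)
    also have "\<dots> = mat_shift d M (mat_shift d N \<psi>) j i"
      using True by (simp add: mat_shift_def shift_poly_sum_right)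
    finally show ?thesis .
  qed (simp add: mat_shift_def)
qed

lemma mat_shift_scalar_mat:
  assumes "\<psi> \<in> seq_space d"
  shows "mat_shift d (p \<cdot>\<^sub>m 1\<^sub>m d) \<psi> = shift_poly_seq p \<psi>"
proof (intro ext)
  fix j i
  show "mat_shift d (p \<cdot>\<^sub>m 1\<^sub>m d) \<psi> j i = shift_poly_seq p \<psi> j i"
  proof (cases "i < d")
    case True
    have "mat_shift d (p \<cdot>\<^sub>m 1\<^sub>m d) \<psi> j i =
        (\<Sum>k<d. if k = i then shift_poly p (\<lambda>j. \<psi> j k) j else 0)"
      unfolding mat_shift_def if_P[OF True] by (rule sum.cong) (use True in auto)
    also have "\<dots> = shift_poly_seq p \<psi> j i"
      using True by (simp add: shift_poly_seq_def)
    finally show ?thesis .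
  next
    case False
    then show ?thesis using assms by (simp add: mat_shift_def shift_poly_seq_def seq_space_def)
  qed
qed

lemma mat_shift_kernel_det:
  assumes "M \<in> carrier_mat d d" "\<psi> \<in> seq_space d" "mat_shift d M \<psi> = 0"
  shows "shift_poly_seq (det M) \<psi> = 0"
  using mat_shift_mult[OF adj_mat(1)[OF assms(1)] assms(1), of \<psi>] assms
  by (simp add: adj_mat mat_shift_scalar_mat)

lemma symbol_poly_mat_carrier: "symbol_poly_mat d a p q \<in> carrier_mat d d"
  by (simp add: symbol_poly_mat_def)

text \<open>The offset \<open>j - p\<close> reflects the factor w^{-p} by which
  \<open>symbol_poly_mat\<close> differs from the symbol.\<close>

lemma mat_shift_symbol_poly_mat:
  "mat_shift d (symbol_poly_mat d a p q) \<psi> j i = bbl d a p q \<psi> (j - p) i"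
proof (cases "i < d")
  case True
  have "mat_shift d (symbol_poly_mat d a p q) \<psi> j i =
      (\<Sum>k<d. \<Sum>r\<in>{p..q}. a r $$ (i, k) * \<psi> (j - p + r) k)"
    using True
    by (auto simp: mat_shift_def symbol_poly_mat_def shift_poly_poly_sum shift_poly_monom
        algebra_simps intro!: sum.cong)
  also have "\<dots> = (\<Sum>r\<in>{p..q}. \<Sum>k<d. a r $$ (i, k) * \<psi> (j - p + r) k)"
    by (rule sum.swap)
  finally show ?thesis using True by (simp add: bbl_def)
qed (simp add: mat_shift_def bbl_def)

lemma bbl_kernel_eq_mat_shift_kernel:
  "bbl_kernel d a p q = {\<psi> \<in> seq_space d. mat_shift d (symbol_poly_mat d a p q) \<psi> = 0}"
proof -
  have "bbl d a p q \<psi> = 0 \<longleftrightarrow> mat_shift d (symbol_poly_mat d a p q) \<psi> = 0" for \<psi>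
  proof
    assume "mat_shift d (symbol_poly_mat d a p q) \<psi> = 0"
    then have "bbl d a p q \<psi> (j + p - p) i = 0" for j i
      unfolding mat_shift_symbol_poly_mat[symmetric] by simp
    then show "bbl d a p q \<psi> = 0" by (simp add: fun_eq_iff)
  qed (simp add: fun_eq_iff mat_shift_symbol_poly_mat)
  then show ?thesis by (auto simp: bbl_kernel_def)
qed

lemma subspace_mat_shift_kernel: "seq.subspace {\<psi> \<in> seq_space d. mat_shift d M \<psi> = 0}"
  using subspace_seq_space[of d]
  by (auto simp: seq.subspace_def mat_shift_add mat_shift_scale)

lemma subspace_bbl_kernel: "seq.subspace (bbl_kernel d a p q)"
  unfolding bbl_kernel_eq_mat_shift_kernel by (rule subspace_mat_shift_kernel)

section \<open>The spaces spanned by the sequences \<open>\<Phi>\<^bsub>z,v\<^esub> e\<^sub>m\<close>\<close>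

text \<open>The layout of \<open>T_embed\<close>: block \<open>v\<close> is counted from 1,
  component \<open>m\<close> from 0.\<close>

lemma block_index_less:
  fixes v s m d :: nat
  assumes "v \<in> {1..s}" "m < d"
  shows "(v - 1) * d + m < d * s"
proof -
  have "(v - 1) * d + m < (v - 1) * d + d" using assms by simp
  also have "\<dots> = v * d" using assms by (cases v) auto
  also have "\<dots> \<le> d * s" using assms by (simp add: mult.commute)
  finally show ?thesis .
qed

text \<open>T - z acts on each component separately, so \<open>Phi_kernel_iff\<close> provides the
  coefficients component by component; collected into blocks they form the vector.\<close>

lemma T_embed_image:
  assumes "z \<noteq> 0"
  shows "T_embed d z s ` carrier_vec (d * s) =
    {\<psi> \<in> seq_space d. shift_poly_seq ([:-z, 1:] ^ s) \<psi> = 0}"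
proof (intro equalityI subsetI)
  fix \<psi> assume "\<psi> \<in> T_embed d z s ` carrier_vec (d * s)"
  then obtain x where \<psi>: "\<psi> = T_embed d z s x" by blast
  have "shift_poly ([:-z, 1:] ^ s) (\<lambda>j. \<psi> j m) = (\<lambda>j. 0)" for m
  proof (cases "m < d")
    case True
    then have "(\<lambda>j. \<psi> j m) = (\<lambda>j. \<Sum>v\<in>{1..s}. x $ ((v - 1) * d + m) * Phi z v j)"
      by (simp add: \<psi> T_embed_def mult.commute)
    then show ?thesis
      by (subst Phi_kernel_iff[OF assms]) (rule exI[of _ "\<lambda>v. x $ ((v - 1) * d + m)"])
  qed (simp add: \<psi> T_embed_def)
  then show "\<psi> \<in> {\<psi> \<in> seq_space d. shift_poly_seq ([:-z, 1:] ^ s) \<psi> = 0}"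
    by (simp add: shift_poly_seq_def fun_eq_iff seq_space_def \<psi> T_embed_def)
next
  fix \<psi> assume "\<psi> \<in> {\<psi> \<in> seq_space d. shift_poly_seq ([:-z, 1:] ^ s) \<psi> = 0}"
  then have \<psi>: "\<psi> \<in> seq_space d" "shift_poly_seq ([:-z, 1:] ^ s) \<psi> = 0" by auto
  have "shift_poly ([:-z, 1:] ^ s) (\<lambda>j. \<psi> j m) = (\<lambda>j. 0)" for m
    using \<psi>(2) by (simp add: shift_poly_seq_def fun_eq_iff)
  then have "\<forall>m. \<exists>c. (\<lambda>j. \<psi> j m) = (\<lambda>j. \<Sum>v\<in>{1..s}. c v * Phi z v j)"
    using Phi_kernel_iff[OF assms] by blast
  then obtain c where c: "(\<lambda>j. \<psi> j m) = (\<lambda>j. \<Sum>v\<in>{1..s}. c m v * Phi z v j)" for m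
    by metis
  \<comment> \<open>Blocks of \<open>x\<close> are counted from 0, the sequences
    \<open>Phi z v\<close> from 1, hence the \<open>Suc\<close>.\<close>
  define x where "x = vec (d * s) (\<lambda>i. c (i mod d) (Suc (i div d)))"
  have x: "x $ ((v - 1) * d + m) = c m v" if "v \<in> {1..s}" "m < d" for v m
    using block_index_less[OF that] that by (simp add: x_def)
  have "\<psi> = T_embed d z s x"
  proof (intro ext)
    fix j m
    show "\<psi> j m = T_embed d z s x j m"
    proof (cases "m < d")
      case True
      then show ?thesis using c[of m] x[OF _ True]
        by (simp add: T_embed_def fun_eq_iff mult.commute)
    next
      case False
      then show ?thesis using \<psi>(1) by (simp add: T_embed_def seq_space_def)
    qed
  qed
  moreover have "x \<in> carrier_vec (d * s)" by (simp add: x_def)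
  ultimately show "\<psi> \<in> T_embed d z s ` carrier_vec (d * s)" by blast
qed

text \<open>Turns the span into a kernel, the form in which the decomposition and the dimension
  count use it.\<close>

lemma T_space_eq_kernel:
  assumes "z \<noteq> 0"
  shows "T_space d z s = {\<psi> \<in> seq_space d. shift_poly_seq ([:-z, 1:] ^ s) \<psi> = 0}"
proof (rule equalityI)
  define gen where "gen v e = (\<lambda>j m. if m = e then Phi z v j else 0)" for v and e :: nat
  have T: "T_space d z s = seq.span {gen v e | v e. 1 \<le> v \<and> v \<le> s \<and> e < d}"
    by (simp add: T_space_def gen_def)
  show "T_space d z s \<subseteq> {\<psi> \<in> seq_space d. shift_poly_seq ([:-z, 1:] ^ s) \<psi> = 0}"
    unfolding T
  proof (rule seq.span_minimal[OF _ subspace_shift_poly_kernel], clarify)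
    fix v e assume *: "1 \<le> v" "v \<le> s" "e < d"
    \<comment> \<open>Kronecker coefficients present the generator in the form that
      \<open>Phi_kernel_iff\<close> asks for.\<close>
    have "Phi z v = (\<lambda>j. \<Sum>w\<in>{1..s}. (if w = v then 1 else 0) * Phi z w j)"
      using * by (auto simp: if_distrib[of "\<lambda>c. c * _"] cong: if_cong)
    then have "shift_poly ([:-z, 1:] ^ s) (Phi z v) = (\<lambda>j. 0)"
      by (subst Phi_kernel_iff[OF assms]) (rule exI[of _ "\<lambda>w. if w = v then 1 else 0"])
    then have "shift_poly ([:-z, 1:] ^ s) (\<lambda>j. gen v e j m) = (\<lambda>j. 0)" for m
      by (cases "m = e") (simp_all add: gen_def)
    then show "gen v e \<in> seq_space d \<and> shift_poly_seq ([:-z, 1:] ^ s) (gen v e) = 0"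
      using * by (simp add: shift_poly_seq_def fun_eq_iff seq_space_def gen_def)
  qed
  show "{\<psi> \<in> seq_space d. shift_poly_seq ([:-z, 1:] ^ s) \<psi> = 0} \<subseteq> T_space d z s"
    unfolding T_embed_image[OF assms, symmetric]
  proof clarify
    fix x :: "complex vec"
    have "T_embed d z s x =
        (\<Sum>v\<in>{1..s}. \<Sum>e<d. seq_scale (x $ ((v - 1) * d + e)) (gen v e))"
    proof (intro ext)
      fix j m
      have "(\<Sum>e<d. x $ ((v - 1) * d + e) * gen v e j m) =
          (\<Sum>e<d. if e = m then Phi z v j * x $ ((v - 1) * d + m) else 0)" for v
        by (rule sum.cong) (auto simp: gen_def)
      then show "T_embed d z s x j m =
          (\<Sum>v\<in>{1..s}. \<Sum>e<d. seq_scale (x $ ((v - 1) * d + e)) (gen v e)) j m"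
        by (simp add: sum_seq_apply T_embed_def seq_scale_def)
    qed
    also have "\<dots> \<in> T_space d z s"
      unfolding T by (intro seq.span_sum seq.span_scale seq.span_base) auto
    finally show "T_embed d z s x \<in> T_space d z s" .
  qed
qed

text \<open>Entry \<open>i\<close> is the coefficient of \<open>Phi z (Suc (i div d))\<close> in
  component \<open>i mod d\<close>, and \<open>Phi_independent\<close> recovers it.\<close>

lemma T_embed_inj_on: "inj_on (T_embed d z s) (carrier_vec (d * s))"
proof (rule inj_onI)
  fix x y :: "complex vec"
  assume xy: "x \<in> carrier_vec (d * s)" "y \<in> carrier_vec (d * s)"
    and eq: "T_embed d z s x = T_embed d z s y"
  show "x = y"
  proof (rule eq_vecI)
    fix i assume "i < dim_vec y"
    then have i: "i < d * s" using xy by simp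
    then have "d > 0" by (cases d) auto
    then have m: "i mod d < d" by simp
    have v: "Suc (i div d) \<in> {1..s}"
      using i by (simp add: less_mult_imp_div_less mult.commute Suc_leI)
    have "(\<Sum>v\<in>{1..s}. (x $ ((v - 1) * d + i mod d) - y $ ((v - 1) * d + i mod d)) * Phi z v j) = 0"
      for j
      using fun_cong[OF fun_cong[OF eq, of j], of "i mod d"] m
      by (simp add: T_embed_def algebra_simps sum_subtractf)
    from Phi_independent[where c = "\<lambda>v. x $ ((v - 1) * d + i mod d) - y $ ((v - 1) * d + i mod d)",
        OF this v]
    show "x $ i = y $ i" by simp
  qed (use xy in simp)
qed

lemma T_embed_bij_betw:
  assumes "z \<noteq> 0"
  shows "bij_betw (T_embed d z s) (carrier_vec (d * s)) (T_space d z s)"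
  using assms by (simp add: bij_betw_def T_embed_inj_on T_embed_image T_space_eq_kernel)

section \<open>The block matrix as the matrix of the transformation on
  \<open>T_space\<close>\<close>

lemma sum_swap_triple:
  "(\<Sum>a\<in>A. \<Sum>b\<in>B. \<Sum>c\<in>C. g a b c) = (\<Sum>c\<in>C. \<Sum>b\<in>B. \<Sum>a\<in>A. g a b c)"
proof -
  have "(\<Sum>a\<in>A. \<Sum>b\<in>B. \<Sum>c\<in>C. g a b c) = (\<Sum>a\<in>A. \<Sum>c\<in>C. \<Sum>b\<in>B. g a b c)"
    by (intro sum.cong refl sum.swap)
  also have "\<dots> = (\<Sum>c\<in>C. \<Sum>a\<in>A. \<Sum>b\<in>B. g a b c)"
    by (rule sum.swap)
  also have "\<dots> = (\<Sum>c\<in>C. \<Sum>b\<in>B. \<Sum>a\<in>A. g a b c)"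
    by (intro sum.cong refl sum.swap)
  finally show ?thesis .
qed

lemma sum_swap_quadruple:
  "(\<Sum>a\<in>A. \<Sum>b\<in>B. \<Sum>c\<in>C. \<Sum>e\<in>E. g a b c e) = (\<Sum>e\<in>E. \<Sum>c\<in>C. \<Sum>b\<in>B. \<Sum>a\<in>A. g a b c e)"
proof -
  have "(\<Sum>a\<in>A. \<Sum>b\<in>B. \<Sum>c\<in>C. \<Sum>e\<in>E. g a b c e) = (\<Sum>a\<in>A. \<Sum>e\<in>E. \<Sum>c\<in>C. \<Sum>b\<in>B. g a b c e)"
    by (intro sum.cong refl sum_swap_triple)
  also have "\<dots> = (\<Sum>e\<in>E. \<Sum>a\<in>A. \<Sum>c\<in>C. \<Sum>b\<in>B. g a b c e)"
    by (rule sum.swap)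
  also have "\<dots> = (\<Sum>e\<in>E. \<Sum>c\<in>C. \<Sum>a\<in>A. \<Sum>b\<in>B. g a b c e)"
    by (rule sum.cong[OF refl], rule sum.swap)
  also have "\<dots> = (\<Sum>e\<in>E. \<Sum>c\<in>C. \<Sum>b\<in>B. \<Sum>a\<in>A. g a b c e)"
    by (rule sum.cong[OF refl], rule sum.cong[OF refl], rule sum.swap)
  finally show ?thesis .
qed

lemma sum_blocks:
  "(\<Sum>l<d * s. f l) = (\<Sum>w<s. \<Sum>k<d. f (w * d + k :: nat))"
proof -
  have "(\<Sum>l<d * s. f l) = (\<Sum>w<s. sum f {w * d..<w * d + d})"
    by (simp add: sum.nat_group mult.commute)
  also have "\<dots> = (\<Sum>w<s. \<Sum>k<d. f (w * d + k))"
  proof (rule sum.cong[OF refl])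
    fix w
    show "sum f {w * d..<w * d + d} = (\<Sum>k<d. f (w * d + k))"
      using sum.shift_bounds_nat_ivl[of f 0 "w * d" d]
      by (simp add: atLeast0LessThan add.commute)
  qed
  finally show ?thesis .
qed

lemma block_symbol_carrier: "block_symbol d a p q s z \<in> carrier_mat (d * s) (d * s)"
  by (simp add: block_symbol_def)

lemma block_symbol_index:
  assumes "x < s" "w < s" "i < d" "k < d"
  shows "block_symbol d a p q s z $$ (x * d + i, w * d + k) =
    (if x \<le> w then of_nat (w choose x) *
       (\<Sum>r\<in>{p..q}. ffact_int r (w - x) * z powi (r - int (w - x)) * a r $$ (i, k)) else 0)"
proof -
  have "x * d + i < d * s" "w * d + k < d * s"
    using block_index_less[of "Suc x" s i d] block_index_less[of "Suc w" s k d] assms by auto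
  then show ?thesis
    using assms by (simp add: block_symbol_def symbol_deriv_def Let_def)
qed

text \<open>Expanding the sequences \<open>Phi\<close> at \<open>j + r\<close> by
  \<open>Phi_Leibniz\<close> and collecting the multiples of \<open>Phi z (Suc y) j\<close> produces
  row block \<open>y\<close> of the matrix.\<close>

lemma bbl_T_embed:
  assumes "z \<noteq> 0" "x \<in> carrier_vec (d * s)"
  shows "bbl d a p q (T_embed d z s x) = T_embed d z s (block_symbol d a p q s z *\<^sub>v x)"
proof (intro ext)
  fix j i
  show "bbl d a p q (T_embed d z s x) j i = T_embed d z s (block_symbol d a p q s z *\<^sub>v x) j i"
  proof (cases "i < d")
    case True
    \<comment> \<open>The common summand of both sides: \<open>r\<close> is the exponent in the
      symbol, \<open>k\<close> a component, \<open>w\<close> the block of \<open>x\<close>,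
      \<open>y\<close> the block of the result. The value 0 for \<open>y > w\<close> fills the
      Leibniz sum up to \<open>s\<close> terms and matches the zero blocks.\<close>
    define F where "F r k w y = (if y \<le> w then of_nat (w choose y) * Phi z (Suc y) j *
        (ffact_int r (w - y) * z powi (r - int (w - y))) * a r $$ (i, k) * x $ (w * d + k) else 0)"
      for r k w y
    have emb: "T_embed d z s x (j + r) k = (\<Sum>w<s. Phi z (Suc w) (j + r) * x $ (w * d + k))"
      if "k < d" for r k
      using that by (simp add: T_embed_def sum.atLeast1_atMost_eq)
    have L: "a r $$ (i, k) * (Phi z (Suc w) (j + r) * x $ (w * d + k)) = (\<Sum>y<s. F r k w y)"
      if "w < s" for r k w
    proof -
      have "a r $$ (i, k) * (Phi z (Suc w) (j + r) * x $ (w * d + k)) = (\<Sum>y\<le>w. F r k w y)"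
        unfolding Phi_Leibniz[OF assms(1)] sum_distrib_left sum_distrib_right
        by (rule sum.cong) (auto simp: F_def)
      also have "\<dots> = (\<Sum>y<s. F r k w y)"
        by (rule sum.mono_neutral_left) (use that in \<open>auto simp: F_def\<close>)
      finally show ?thesis .
    qed
    have R: "(block_symbol d a p q s z *\<^sub>v x) $ (y * d + i) * Phi z (Suc y) j =
        (\<Sum>w<s. \<Sum>k<d. \<Sum>r\<in>{p..q}. F r k w y)" if "y < s" for y
    proof -
      have "y * d + i < d * s"
        using block_index_less[of "Suc y" s i d] that True by auto
      then have "(block_symbol d a p q s z *\<^sub>v x) $ (y * d + i) =
          (\<Sum>l<d * s. block_symbol d a p q s z $$ (y * d + i, l) * x $ l)"
        using assms(2) block_symbol_carrier[of d a p q s z]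
        by (auto simp: scalar_prod_def atLeast0LessThan intro!: sum.cong)
      also have "\<dots> = (\<Sum>w<s. \<Sum>k<d.
          block_symbol d a p q s z $$ (y * d + i, w * d + k) * x $ (w * d + k))"
        by (rule sum_blocks)
      finally have "(block_symbol d a p q s z *\<^sub>v x) $ (y * d + i) * Phi z (Suc y) j = \<dots> * Phi z (Suc y) j"
        by simp
      also have "\<dots> = (\<Sum>w<s. \<Sum>k<d. \<Sum>r\<in>{p..q}. F r k w y)"
        unfolding sum_distrib_right
      proof (intro sum.cong refl)
        fix w k assume "w \<in> {..<s}" "k \<in> {..<d}"
        then show "block_symbol d a p q s z $$ (y * d + i, w * d + k) * x $ (w * d + k) *
            Phi z (Suc y) j = (\<Sum>r\<in>{p..q}. F r k w y)"
          using block_symbol_index[OF that _ True, of w k a p q z]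
          by (simp add: F_def sum_distrib_left sum_distrib_right mult_ac)
      qed
      finally show ?thesis .
    qed
    have "bbl d a p q (T_embed d z s x) j i =
        (\<Sum>r\<in>{p..q}. \<Sum>k<d. \<Sum>w<s. \<Sum>y<s. F r k w y)"
      using True by (simp add: bbl_def emb sum_distrib_left L)
    also have "\<dots> = (\<Sum>y<s. \<Sum>w<s. \<Sum>k<d. \<Sum>r\<in>{p..q}. F r k w y)"
      by (rule sum_swap_quadruple)
    also have "\<dots> = (\<Sum>y<s. (block_symbol d a p q s z *\<^sub>v x) $ (y * d + i) * Phi z (Suc y) j)"
      by (rule sum.cong) (simp_all add: R)
    also have "\<dots> = T_embed d z s (block_symbol d a p q s z *\<^sub>v x) j i"
      using True by (simp add: T_embed_def sum.atLeast1_atMost_eq mult.commute)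
    finally show ?thesis .
  qed (simp add: bbl_def T_embed_def)
qed

lemma T_embed_zero: "T_embed d z s (0\<^sub>v (d * s)) = 0"
proof (intro ext)
  fix j m
  show "T_embed d z s (0\<^sub>v (d * s)) j m = 0 j m"
  proof (cases "m < d")
    case True
    then show ?thesis by (simp add: T_embed_def block_index_less del: One_nat_def)
  qed (simp add: T_embed_def)
qed

text \<open>\<open>bbl_T_embed\<close> replaces the transformation by the block matrix, and since
  \<open>T_embed\<close> is injective the image is zero exactly when the vector is.\<close>

lemma T_embed_mat_kernel:
  assumes "z \<noteq> 0"
  shows "T_embed d z s ` mat_kernel (block_symbol d a p q s z) = bbl_kernel d a p q \<inter> T_space d z s"
proof -
  have img: "T_space d z s = T_embed d z s ` carrier_vec (d * s)"
    and sub: "T_space d z s \<subseteq> seq_space d"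
    using assms by (auto simp: T_embed_image T_space_eq_kernel)
  have "bbl d a p q (T_embed d z s x) = 0 \<longleftrightarrow> block_symbol d a p q s z *\<^sub>v x = 0\<^sub>v (d * s)"
    if x: "x \<in> carrier_vec (d * s)" for x
  proof -
    have "block_symbol d a p q s z *\<^sub>v x \<in> carrier_vec (d * s)"
      using block_symbol_carrier x by (rule mult_mat_vec_carrier)
    from inj_on_eq_iff[OF T_embed_inj_on this zero_carrier_vec, of z]
    show ?thesis
      by (simp only: bbl_T_embed[OF assms x] T_embed_zero)
  qed
  then show ?thesis
    using sub unfolding mat_kernel[OF block_symbol_carrier] img bbl_kernel_def by auto
qed

section \<open>Primary decomposition\<close>

text \<open>Multiply the identity for exponent n by the one for exponent 1; the latter comes from
  the remainder of q on division by w - z, the nonzero constant \<open>poly q z\<close>.\<close>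

lemma bezout_linear_power:
  fixes q :: "complex poly"
  assumes "poly q z \<noteq> 0"
  shows "\<exists>u v. u * [:-z, 1:] ^ n + v * q = 1"
proof (induction n)
  case 0
  have "1 * [:-z, 1:] ^ 0 + 0 * q = 1" by simp
  then show ?case by blast
next
  case (Suc n)
  then obtain u v where uv: "u * [:-z, 1:] ^ n + v * q = 1" by blast
  define c where "c = poly q z"
  have "[:-z, 1:] dvd q - [:c:]"
    by (simp add: poly_eq_0_iff_dvd[symmetric] c_def)
  then obtain r where r: "q - [:c:] = [:-z, 1:] * r" by (rule dvdE)
  have "[:1 / c:] * (q - [:-z, 1:] * r) = [:1 / c:] * [:c:]"
    by (simp only: r[symmetric]) simp
  also have "\<dots> = 1" using assms by (simp add: c_def one_pCons)
  finally have inv: "[:1 / c:] * (q - [:-z, 1:] * r) = 1" .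
  have "- (x * r) * y + x * q = x * (q - y * r)" for x y
    by (simp add: algebra_simps)
  then have ab: "- ([:1 / c:] * r) * [:-z, 1:] + [:1 / c:] * q = 1"
    unfolding inv[symmetric] by blast
  define a b where "a = - ([:1 / c:] * r)" and "b = [:1 / c:]"
  \<comment> \<open>In this product every term except the one with \<open>u * a\<close> contains the
    factor \<open>q\<close>.\<close>
  have "(u * [:-z, 1:] ^ n + v * q) * (a * [:-z, 1:] + b * q) = 1"
    unfolding uv a_def b_def ab by simp
  moreover have "(u * [:-z, 1:] ^ n + v * q) * (a * [:-z, 1:] + b * q) =
      (u * a) * [:-z, 1:] ^ Suc n + (u * [:-z, 1:] ^ n * b + v * a * [:-z, 1:] + v * b * q) * q"
    unfolding power_Suc by (simp only: algebra_simps)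
  ultimately show ?case by metis
qed

text \<open>Apply Bezout's identity for the two polynomials to \<psi>; both terms vanish.\<close>

lemma coprime_kernels_trivial:
  assumes "poly q z \<noteq> 0" "shift_poly_seq ([:-z, 1:] ^ n) \<psi> = 0" "shift_poly_seq q \<psi> = 0"
  shows "\<psi> = 0"
proof -
  from bezout_linear_power[OF assms(1)]
  obtain u v where "u * [:-z, 1:] ^ n + v * q = 1" by blast
  then have "\<psi> = shift_poly_seq (u * [:-z, 1:] ^ n + v * q) \<psi>" by simp
  also have "\<dots> = 0"
    unfolding shift_poly_seq_poly_add shift_poly_seq_mult assms(2,3) shift_poly_seq_zero by simp
  finally show ?thesis .
qed

text \<open>The summands are images of \<psi> under polynomials in T, so they remain in any subspace
  invariant under T. For one root, Bezout writes \<psi> as a part killed by its power and a part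
  killed by the remaining product, to which the induction hypothesis applies.\<close>

lemma kernel_prod_decomposition:
  assumes "finite S" "shift_poly_seq (\<Prod>z\<in>S. [:-z, 1:] ^ n z) \<psi> = 0"
  shows "\<exists>r. \<psi> = (\<Sum>z\<in>S. shift_poly_seq (r z) \<psi>) \<and>
    (\<forall>z\<in>S. shift_poly_seq ([:-z, 1:] ^ n z) (shift_poly_seq (r z) \<psi>) = 0)"
  using assms
proof (induction S arbitrary: \<psi> rule: finite_induct)
  case empty
  then show ?case by simp
next
  case (insert z S)
  define p1 p2 where "p1 = [:-z, 1:] ^ n z" and "p2 = (\<Prod>y\<in>S. [:-y, 1:] ^ n y)"
  have p12: "shift_poly_seq (p1 * p2) \<psi> = 0"
    using insert.prems insert.hyps by (simp only: p1_def p2_def prod.insert not_False_eq_True)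
  have "poly p2 z \<noteq> 0"
    using insert.hyps by (auto simp: p2_def poly_prod)
  from bezout_linear_power[OF this]
  obtain u v where uv: "u * p1 + v * p2 = 1" unfolding p1_def by blast
  have "shift_poly_seq p2 (shift_poly_seq (u * p1) \<psi>) = shift_poly_seq (u * (p1 * p2)) \<psi>"
    by (simp only: shift_poly_seq_mult[symmetric]) (simp only: mult_ac)
  also have "\<dots> = 0"
    by (simp only: shift_poly_seq_mult[of u] p12 shift_poly_seq_zero)
  finally have "shift_poly_seq p2 (shift_poly_seq (u * p1) \<psi>) = 0" .
  from insert.IH[OF this[unfolded p2_def]] obtain r where
    r: "shift_poly_seq (u * p1) \<psi> = (\<Sum>y\<in>S. shift_poly_seq (r y) (shift_poly_seq (u * p1) \<psi>))"
    and r0: "\<And>y. y \<in> S \<Longrightarrow>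
      shift_poly_seq ([:-y, 1:] ^ n y) (shift_poly_seq (r y) (shift_poly_seq (u * p1) \<psi>)) = 0"
    by blast
  \<comment> \<open>The induction hypothesis decomposes
    \<open>shift_poly_seq (u * p1) \<psi>\<close>; the factor \<open>u * p1\<close> restates its
    polynomials relative to \<psi>.\<close>
  define r' where "r' y = (if y = z then v * p2 else r y * (u * p1))" for y
  have S: "shift_poly_seq (r' y) \<psi> = shift_poly_seq (r y) (shift_poly_seq (u * p1) \<psi>)"
    if "y \<in> S" for y
    using that insert.hyps by (auto simp: r'_def shift_poly_seq_mult)
  have "\<psi> = shift_poly_seq (u * p1 + v * p2) \<psi>" by (simp add: uv)
  also have "\<dots> = shift_poly_seq (v * p2) \<psi> + shift_poly_seq (u * p1) \<psi>"
    by (simp only: shift_poly_seq_poly_add add.commute)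
  also have "\<dots> = shift_poly_seq (r' z) \<psi> + (\<Sum>y\<in>S. shift_poly_seq (r' y) \<psi>)"
    using r by (simp only: S cong: sum.cong) (simp add: r'_def)
  also have "\<dots> = (\<Sum>y\<in>insert z S. shift_poly_seq (r' y) \<psi>)"
    using insert.hyps by simp
  finally have sum: "\<psi> = (\<Sum>y\<in>insert z S. shift_poly_seq (r' y) \<psi>)" .
  have "shift_poly_seq p1 (shift_poly_seq (v * p2) \<psi>) = shift_poly_seq (v * (p1 * p2)) \<psi>"
    by (simp only: shift_poly_seq_mult[symmetric]) (simp only: mult_ac)
  also have "\<dots> = 0"
    by (simp only: shift_poly_seq_mult[of v] p12 shift_poly_seq_zero)
  finally have "shift_poly_seq ([:-z, 1:] ^ n z) (shift_poly_seq (r' z) \<psi>) = 0"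
    by (simp add: p1_def r'_def)
  note z = this
  have "shift_poly_seq ([:-y, 1:] ^ n y) (shift_poly_seq (r' y) \<psi>) = 0" if "y \<in> insert z S" for y
  proof (cases "y = z")
    case False
    with that have "y \<in> S" by simp
    then show ?thesis unfolding S[OF \<open>y \<in> S\<close>] by (rule r0)
  qed (simp only: z)
  with sum show ?case by blast
qed

lemma shift_power_kernel_trivial:
  assumes "shift_poly_seq ([:0, 1:] ^ n) \<psi> = 0"
  shows "\<psi> = 0"
proof -
  have "shift_poly_seq (monom 1 n) \<psi> = 0"
    using assms by (simp add: monom_altdef)
  then have "shift_poly_seq (monom 1 n) \<psi> (j - int n) m = 0" for j m
    by simp
  then have "\<psi> j m = 0" for j m
    by (simp add: shift_poly_seq_def shift_poly_monom)
  then show ?thesis by (simp add: fun_eq_iff)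
qed

text \<open>Existence comes from factoring det M over its roots, uniqueness from Bezout's identity
  for one factor against the product of the others.\<close>

lemma kernel_direct_sum:
  assumes M: "M \<in> carrier_mat d d" and det: "det M \<noteq> 0"
    and K: "K = {\<psi> \<in> seq_space d. mat_shift d M \<psi> = 0}"
    and Z: "Z = {z. z \<noteq> 0 \<and> poly (det M) z = 0}"
  shows "internal_direct_sum K Z (\<lambda>z. K \<inter> T_space d z (order z (det M)))"
proof -
  define P where "P = det M"
  have K_sub: "seq.subspace K"
    unfolding K by (rule subspace_mat_shift_kernel)
  have fin: "finite {z. poly P z = 0}"
    using det by (simp add: P_def poly_roots_finite)
  have finZ: "finite Z"
    using fin by (rule rev_finite_subset) (auto simp: Z P_def)
  have T: "T_space d z s = {\<psi> \<in> seq_space d. shift_poly_seq ([:-z, 1:] ^ s) \<psi> = 0}" if "z \<in> Z" for z s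
    using that by (intro T_space_eq_kernel) (simp add: Z)
  have "\<exists>f. (\<forall>z\<in>Z. f z \<in> K \<inter> T_space d z (order z P)) \<and> \<psi> = (\<Sum>z\<in>Z. f z)"
    if \<psi>: "\<psi> \<in> K" for \<psi>
  proof -
    have "shift_poly_seq P \<psi> = 0"
      using mat_shift_kernel_det[OF M] \<psi> by (simp add: K P_def)
    then have "seq_scale (lead_coeff P)
        (shift_poly_seq (\<Prod>z|poly P z = 0. [:-z, 1:] ^ order z P) \<psi>) = 0"
      by (simp only: shift_poly_seq_smult[symmetric] complex_poly_decompose)
    then have "shift_poly_seq (\<Prod>z|poly P z = 0. [:-z, 1:] ^ order z P) \<psi> = 0"
      using det by (auto simp only: seq.scale_eq_0_iff P_def leading_coeff_0_iff)
    from kernel_prod_decomposition[OF fin this] obtain r where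
      sum: "\<psi> = (\<Sum>z|poly P z = 0. shift_poly_seq (r z) \<psi>)"
      and r0: "\<And>z. poly P z = 0 \<Longrightarrow>
        shift_poly_seq ([:-z, 1:] ^ order z P) (shift_poly_seq (r z) \<psi>) = 0"
      by auto
    \<comment> \<open>A root of \<open>P\<close> outside \<open>Z\<close> is 0, whose summand
      vanishes because T is injective.\<close>
    have zero: "shift_poly_seq (r z) \<psi> = 0" if "poly P z = 0" "z \<notin> Z" for z
      using shift_power_kernel_trivial[of "order z P"] r0[OF that(1)] that by (simp add: Z P_def)
    have "\<psi> = (\<Sum>z\<in>Z. shift_poly_seq (r z) \<psi>)"
      by (subst sum, rule sum.mono_neutral_right) (use fin zero in \<open>auto simp: Z P_def\<close>)
    moreover have "shift_poly_seq (r z) \<psi> \<in> K \<inter> T_space d z (order z P)" if "z \<in> Z" for z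
    proof -
      have "poly P z = 0" using that by (simp add: Z P_def)
      then show ?thesis
        unfolding T[OF that] K
        using \<psi>[unfolded K] r0 by (auto simp: mat_shift_shift_poly_seq shift_poly_seq_in_seq_space)
    qed
    ultimately show ?thesis
      by (intro exI[of _ "\<lambda>z. shift_poly_seq (r z) \<psi>"]) blast
  qed
  moreover have "(\<Sum>z\<in>Z. f z) \<in> K" if "\<forall>z\<in>Z. f z \<in> K \<inter> T_space d z (order z P)" for f
    using that by (intro seq.subspace_sum[OF K_sub]) auto
  ultimately have 1: "K = {(\<Sum>z\<in>Z. f z) | f. \<forall>z\<in>Z. f z \<in> K \<inter> T_space d z (order z P)}"
    by blast
  have 2: "f y = 0" if f: "\<forall>z\<in>Z. f z \<in> K \<inter> T_space d z (order z P)"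
    and sum: "(\<Sum>z\<in>Z. f z) = 0" and y: "y \<in> Z" for f y
  proof -
    \<comment> \<open>The product over the other roots annihilates every summand except the one at
      \<open>y\<close> and does not vanish at \<open>y\<close>.\<close>
    define q where "q = (\<Prod>z\<in>Z - {y}. [:-z, 1:] ^ order z P)"
    have q0: "shift_poly_seq q (f z) = 0" if "z \<in> Z - {y}" for z
    proof (rule shift_poly_seq_dvd)
      show "[:-z, 1:] ^ order z P dvd q"
        unfolding q_def using finZ that by (intro dvd_prodI) auto
      show "shift_poly_seq ([:-z, 1:] ^ order z P) (f z) = 0"
        using f that T by auto
    qed
    have "0 = shift_poly_seq q (\<Sum>z\<in>Z. f z)" by (simp add: sum)
    also have "\<dots> = shift_poly_seq q (f y) + (\<Sum>z\<in>Z - {y}. shift_poly_seq q (f z))"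
      unfolding shift_poly_seq_sum by (rule sum.remove[OF finZ y])
    also have "\<dots> = shift_poly_seq q (f y)"
      by (simp add: q0)
    finally have "shift_poly_seq q (f y) = 0" by simp
    moreover have "poly q y \<noteq> 0"
      using finZ by (auto simp: q_def poly_prod)
    moreover have "shift_poly_seq ([:-y, 1:] ^ order y P) (f y) = 0"
      using f y T by auto
    ultimately show "f y = 0" using coprime_kernels_trivial by blast
  qed
  show ?thesis
    unfolding internal_direct_sum_def P_def[symmetric] using 1 2 by blast
qed

section \<open>The dimension of the kernel at a root\<close>

context vector_space
begin

text \<open>Rank-nullity by lifting: preimages of the elements of \<open>S\<close>, together with
  the vector \<open>e\<close> spanning the kernel, form the required basis. The surrounding space
  may be infinite-dimensional.\<close>

lemma basis_of_preimage:
  assumes f: "Vector_Spaces.linear scale scale f" and W: "subspace W"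
    and S: "finite S" "independent S"
    and e: "e \<in> W" "e \<noteq> 0" "f e = 0"
    and ker: "\<And>x. x \<in> W \<Longrightarrow> f x = 0 \<Longrightarrow> \<exists>c. x = scale c e"
    and img: "f ` W = span S"
  shows "\<exists>B. finite B \<and> card B = Suc (card S) \<and> independent B \<and> span B = W"
proof -
  interpret f: Vector_Spaces.linear scale scale f by (rule f)
  have "\<forall>b\<in>S. \<exists>x. x \<in> W \<and> f x = b"
    using img span_superset[of S] by (metis imageE subsetD)
  then obtain h where h: "\<And>b. b \<in> S \<Longrightarrow> h b \<in> W" "\<And>b. b \<in> S \<Longrightarrow> f (h b) = b"
    by metis
  have inj: "inj_on h S"
    using h(2) by (metis inj_onI)
  have comb: "f (\<Sum>x\<in>h ` S. g x *s x) = (\<Sum>b\<in>S. g (h b) *s b)" for g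
    by (simp add: sum.reindex[OF inj] f.sum f.scale h(2))
  \<comment> \<open>Applying \<open>f\<close> carries a relation among the lifts to one among the
    elements of \<open>S\<close>, which is trivial.\<close>
  have coeff_0: "g x = 0" if "f (\<Sum>x\<in>h ` S. g x *s x) = 0" "x \<in> h ` S" for g x
    using independentD[OF S(2) S(1) order_refl, of "\<lambda>b. g (h b)"] that by (auto simp: comb)
  have indep: "independent (h ` S)"
    by (rule independent_if_scalars_zero) (use S coeff_0 in auto)
  \<comment> \<open>Otherwise the combination of lifts equal to \<open>e\<close> is mapped to 0 by
    \<open>f\<close>, so its coefficients and hence \<open>e\<close> itself vanish.\<close>
  have e_notin: "e \<notin> span (h ` S)"
  proof
    assume "e \<in> span (h ` S)"
    then obtain g where g: "e = (\<Sum>x\<in>h ` S. g x *s x)"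
      using S(1) by (auto simp: span_finite)
    then have "e = 0"
      using coeff_0[of g] e(3) by (simp cong: sum.cong)
    with e(2) show False by simp
  qed
  have "span (insert e (h ` S)) = W"
  proof
    show "span (insert e (h ` S)) \<subseteq> W"
      using e h by (intro span_minimal W) auto
    show "W \<subseteq> span (insert e (h ` S))"
    proof
      fix x assume x: "x \<in> W"
      then have "f x \<in> span S" using img by blast
      then obtain c where c: "f x = (\<Sum>b\<in>S. c b *s b)"
        using S(1) by (auto simp: span_finite)
      \<comment> \<open>\<open>y\<close> lifts \<open>f x\<close>, so \<open>x - y\<close> lies in
        the kernel line spanned by \<open>e\<close>.\<close>
      define y where "y = (\<Sum>b\<in>S. c b *s h b)"
      have "f (x - y) = 0"
        by (simp add: f.diff y_def f.sum f.scale h(2) c)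
      moreover have "y \<in> W"
        unfolding y_def using h by (intro subspace_sum subspace_scale W)
      then have "x - y \<in> W"
        using x W by (simp add: subspace_diff)
      ultimately obtain k where "x - y = k *s e"
        using ker by blast
      then have "x = k *s e + y" by (simp add: algebra_simps)
      also have "\<dots> \<in> span (insert e (h ` S))"
        unfolding y_def by (intro span_add span_scale span_sum span_base) auto
      finally show "x \<in> span (insert e (h ` S))" .
    qed
  qed
  moreover have "card (insert e (h ` S)) = Suc (card S)"
    using e_notin S(1) span_base[of e "h ` S"] by (subst card_insert_disjoint) (auto simp: card_image[OF inj])
  moreover have "independent (insert e (h ` S))"
    using e_notin indep by (rule independent_insertI)
  ultimately show ?thesis
    using S(1) by (intro exI[of _ "insert e (h ` S)"]) auto
qed

end

text \<open>The matrix \<open>E\<close> of the factorization \<open>M = B E\<close>.\<close>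
definition root_factor :: "nat \<Rightarrow> nat \<Rightarrow> complex \<Rightarrow> (nat \<Rightarrow> complex) \<Rightarrow> complex poly mat" where
  "root_factor d k z u = mat d d (\<lambda>(i, j).
     if j = k then (if i = k then [:-z, 1:] else [:- u i:]) else if i = j then 1 else 0)"

lemma root_factor_carrier: "root_factor d k z u \<in> carrier_mat d d"
  by (simp add: root_factor_def)

text \<open>Only column \<open>k\<close> differs from the identity, so Cramer's rule reads the
  determinant off as entry \<open>k\<close> of that column.\<close>

lemma det_root_factor:
  assumes "k < d"
  shows "det (root_factor d k z u) = [:-z, 1:]"
proof -
  define x where "x = vec d (\<lambda>i. if i = k then [:-z, 1:] else [:- u i:])"
  have x: "x \<in> carrier_vec d" by (simp add: x_def)
  have "root_factor d k z u = replace_col (1\<^sub>m d) (1\<^sub>m d *\<^sub>v x) k"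
    unfolding root_factor_def replace_col_def one_mult_mat_vec[OF x]
    by (rule eq_matI) (auto simp: x_def)
  then show ?thesis
    using cramer_lemma_mat[OF one_carrier_mat x assms] assms by (simp add: x_def)
qed

lemma mat_shift_root_factor:
  assumes "k < d" "i < d"
  shows "mat_shift d (root_factor d k z u) \<psi> j i =
    (if i = k then shift_poly [:-z, 1:] (\<lambda>j. \<psi> j k) j else \<psi> j i - u i * \<psi> j k)"
proof -
  have const: "shift_poly [:c:] f j = c * f j" for c f
    by (simp add: shift_poly_def)
  have "mat_shift d (root_factor d k z u) \<psi> j i =
      (\<Sum>l<d. shift_poly (root_factor d k z u $$ (i, l)) (\<lambda>j. \<psi> j l) j)"
    unfolding mat_shift_def if_P[OF assms(2)] ..
  \<comment> \<open>Row \<open>i\<close> can be nonzero only in columns \<open>k\<close> and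
    \<open>i\<close>. For \<open>i = k\<close> these coincide, and the second summand is 0 to avoid
    counting the entry twice.\<close>
  also have "\<dots> = (\<Sum>l<d.
      (if l = k then (if i = k then shift_poly [:-z, 1:] (\<lambda>j. \<psi> j k) j else - u i * \<psi> j k) else 0) +
      (if l = i then (if i = k then 0 else \<psi> j i) else 0))"
    by (rule sum.cong) (use assms in \<open>auto simp: root_factor_def const simp del: minus_pCons\<close>)
  also have "\<dots> = (if i = k then shift_poly [:-z, 1:] (\<lambda>j. \<psi> j k) j else \<psi> j i - u i * \<psi> j k)"
    using assms by (simp add: sum.distrib)
  finally show ?thesis .
qed

text \<open>A null vector of M(z), scaled so that one entry is 1, gives the constants
  \<open>u\<close>. Then M(w) u vanishes at w = z, hence is divisible by w - z, and the quotient
  becomes column \<open>k\<close> of \<open>B\<close>.\<close>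

lemma split_root_factor:
  assumes M: "M \<in> carrier_mat d d" and root: "poly (det M) z = 0"
  obtains B u k where "k < d" "u k = 1" "B \<in> carrier_mat d d" "M = B * root_factor d k z u"
proof -
  interpret ev: comm_ring_hom "\<lambda>p. poly p z"
    by unfold_locales auto
  define N where "N = map_mat (\<lambda>p. poly p z) M"
  have N: "N \<in> carrier_mat d d" using M by (simp add: N_def)
  have "det N = 0" by (simp add: N_def root)
  then obtain v where v: "v \<in> carrier_vec d" "v \<noteq> 0\<^sub>v d" "N *\<^sub>v v = 0\<^sub>v d"
    using det_0_iff_vec_prod_zero_field[OF N] by blast
  then obtain k where k: "k < d" "v $ k \<noteq> 0"
    by (metis carrier_vecD eq_vecI index_zero_vec)
  define u where "u i = v $ i / v $ k" for i
  have u: "u k = 1" using k by (simp add: u_def)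
  define Q where "Q i = (\<Sum>l<d. M $$ (i, l) * [:u l:])" for i
  have "[:-z, 1:] dvd Q i" if "i < d" for i
  proof -
    have "(\<Sum>l<d. poly (M $$ (i, l)) z * v $ l) = (N *\<^sub>v v) $ i"
      using that M v(1) by (auto simp: N_def scalar_prod_def atLeast0LessThan intro!: sum.cong)
    also have "\<dots> = 0" using that v by simp
    finally have "(\<Sum>l<d. poly (M $$ (i, l)) z * v $ l) / v $ k = 0" by simp
    then have "poly (Q i) z = 0"
      by (simp add: Q_def poly_sum u_def sum_divide_distrib mult.commute)
    then show ?thesis by (simp add: poly_eq_0_iff_dvd)
  qed
  then have "\<forall>i. \<exists>r. i < d \<longrightarrow> Q i = [:-z, 1:] * r"
    by (meson dvdE)
  then obtain r where r: "\<And>i. i < d \<Longrightarrow> Q i = [:-z, 1:] * r i" by metis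
  define B where "B = mat d d (\<lambda>(i, j). if j = k then r i else M $$ (i, j))"
  have B: "B \<in> carrier_mat d d" by (simp add: B_def)
  have "M = B * root_factor d k z u"
  proof (rule eq_matI)
    fix i j
    assume "i < dim_row (B * root_factor d k z u)" "j < dim_col (B * root_factor d k z u)"
    then have i: "i < d" and j: "j < d"
      using B by (auto simp: root_factor_def)
    have prod: "(B * root_factor d k z u) $$ (i, j) = (\<Sum>l<d. B $$ (i, l) * root_factor d k z u $$ (l, j))"
      using B root_factor_carrier[of d k z u] i j
      by (auto simp: scalar_prod_def atLeast0LessThan intro!: sum.cong)
    show "M $$ (i, j) = (B * root_factor d k z u) $$ (i, j)"
    proof (cases "j = k")
      case False
      have "(\<Sum>l<d. B $$ (i, l) * root_factor d k z u $$ (l, j)) = (\<Sum>l<d. if l = j then M $$ (i, j) else 0)"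
        by (rule sum.cong) (use False i j in \<open>auto simp: B_def root_factor_def\<close>)
      then show ?thesis unfolding prod using j by simp
    next
      case True
      have "(\<Sum>l<d. B $$ (i, l) * root_factor d k z u $$ (l, j)) =
          [:-z, 1:] * r i + (\<Sum>l\<in>{..<d} - {k}. B $$ (i, l) * root_factor d k z u $$ (l, k))"
        using k i by (subst sum.remove[of _ k]) (auto simp: True B_def root_factor_def mult.commute)
      also have "(\<Sum>l\<in>{..<d} - {k}. B $$ (i, l) * root_factor d k z u $$ (l, k)) =
          - (\<Sum>l\<in>{..<d} - {k}. M $$ (i, l) * [:u l:])"
        unfolding sum_negf[symmetric]
        by (rule sum.cong) (use k i in \<open>auto simp: B_def root_factor_def\<close>)
      \<comment> \<open>The terms of \<open>Q i\<close> with \<open>l\<close> other than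
        \<open>k\<close> cancel against the negated sum, and \<open>u k = 1\<close> leaves
        \<open>M $$ (i, k)\<close>.\<close>
      also have "[:-z, 1:] * r i = M $$ (i, k) * [:u k:] + (\<Sum>l\<in>{..<d} - {k}. M $$ (i, l) * [:u l:])"
        unfolding r[OF i, symmetric] Q_def using k by (subst sum.remove[of _ k]) auto
      finally show ?thesis
        unfolding prod by (simp add: u True flip: one_pCons)
    qed
  qed (use M B root_factor_carrier[of d k z u] in auto)
  with that k(1) u B show ?thesis by blast
qed

section \<open>Generalized eigenspaces of the shift and the kernel of M(T) in them\<close>

text \<open>Leaving the exponent open makes the space independent of the matrix, whose determinant
  changes its order at \<open>z\<close> along the induction.\<close>

definition gen_eigenspace :: "nat \<Rightarrow> complex \<Rightarrow> (int \<Rightarrow> nat \<Rightarrow> complex) set" where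
  "gen_eigenspace d z = {\<psi> \<in> seq_space d. \<exists>n. shift_poly_seq ([:-z, 1:] ^ n) \<psi> = 0}"

lemma subspace_gen_eigenspace: "seq.subspace (gen_eigenspace d z)"
proof (rule seq.subspaceI)
  show "0 \<in> gen_eigenspace d z"
    using seq.subspace_0[OF subspace_seq_space] by (simp add: gen_eigenspace_def)
next
  fix x y assume xy: "x \<in> gen_eigenspace d z" "y \<in> gen_eigenspace d z"
  then obtain m n where mn: "shift_poly_seq ([:-z, 1:] ^ m) x = 0" "shift_poly_seq ([:-z, 1:] ^ n) y = 0"
    by (auto simp: gen_eigenspace_def)
  have "shift_poly_seq ([:-z, 1:] ^ (m + n)) x = 0"
    by (rule shift_poly_seq_dvd[OF _ mn(1)]) (simp add: le_imp_power_dvd)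
  moreover have "shift_poly_seq ([:-z, 1:] ^ (m + n)) y = 0"
    by (rule shift_poly_seq_dvd[OF _ mn(2)]) (simp add: le_imp_power_dvd)
  ultimately have "shift_poly_seq ([:-z, 1:] ^ (m + n)) (x + y) = 0"
    by (simp only: shift_poly_seq_add) simp
  then show "x + y \<in> gen_eigenspace d z"
    using xy seq.subspace_add[OF subspace_seq_space] unfolding gen_eigenspace_def by blast
next
  fix c x assume "x \<in> gen_eigenspace d z"
  then show "seq_scale c x \<in> gen_eigenspace d z"
    using seq.subspace_scale[OF subspace_seq_space]
    by (auto simp: gen_eigenspace_def shift_poly_seq_scale)
qed

lemma mat_shift_gen_eigenspace:
  assumes "\<psi> \<in> gen_eigenspace d z"
  shows "mat_shift d M \<psi> \<in> gen_eigenspace d z"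
proof -
  obtain n where "shift_poly_seq ([:-z, 1:] ^ n) \<psi> = 0"
    using assms by (auto simp: gen_eigenspace_def)
  then have "shift_poly_seq ([:-z, 1:] ^ n) (mat_shift d M \<psi>) = 0"
    by (simp only: mat_shift_shift_poly_seq[symmetric] mat_shift_zero)
  then show ?thesis
    using mat_shift_in_seq_space unfolding gen_eigenspace_def by blast
qed

text \<open>Back substitution: component \<open>k\<close> requires a solution g of the first-order
  equation with right-hand side component \<open>k\<close> of \<phi>, and the other components
  follow from g.\<close>

lemma root_factor_surj:
  assumes "z \<noteq> 0" "k < d" "\<phi> \<in> gen_eigenspace d z"
  shows "\<exists>\<psi>\<in>gen_eigenspace d z. mat_shift d (root_factor d k z u) \<psi> = \<phi>"
proof -
  obtain n where \<phi>: "\<phi> \<in> seq_space d" and n: "shift_poly_seq ([:-z, 1:] ^ n) \<phi> = 0"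
    using assms(3) by (auto simp: gen_eigenspace_def)
  obtain g where g: "shift_poly [:-z, 1:] g = (\<lambda>j. \<phi> j k)"
    using linear_factor_surj[OF assms(1)] by blast
  define \<psi> where "\<psi> = (\<lambda>j i. if i < d then (if i = k then g j else \<phi> j i + u i * g j) else 0)"
  have n': "shift_poly ([:-z, 1:] ^ n) (\<lambda>j. \<phi> j i) = (\<lambda>j. 0)" for i
    using n by (simp add: shift_poly_seq_def fun_eq_iff)
  \<comment> \<open>Solving for \<open>g\<close> costs one further power of T - z, hence
    \<open>Suc n\<close>.\<close>
  have g0: "shift_poly ([:-z, 1:] ^ Suc n) g = (\<lambda>j. 0)"
    by (simp only: power_Suc2 shift_poly_mult g n')
  have \<phi>0: "shift_poly ([:-z, 1:] ^ Suc n) (\<lambda>j. \<phi> j i) = (\<lambda>j. 0)" for i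
    by (simp only: power_Suc shift_poly_mult n' shift_poly_zero_right)
  have "shift_poly ([:-z, 1:] ^ Suc n) (\<lambda>j. \<psi> j i) = (\<lambda>j. 0)" for i
  proof -
    consider "\<not> i < d" | "i < d" "i = k" | "i < d" "i \<noteq> k" by blast
    then show ?thesis
    proof cases
      case 1
      then show ?thesis by (simp add: \<psi>_def del: power_Suc)
    next
      case 2
      then show ?thesis using assms(2) g0 by (simp add: \<psi>_def del: power_Suc)
    next
      case 3
      then have "(\<lambda>j. \<psi> j i) = (\<lambda>j. \<phi> j i + u i * g j)" by (simp add: \<psi>_def)
      then have "shift_poly ([:-z, 1:] ^ Suc n) (\<lambda>j. \<psi> j i) =
          shift_poly ([:-z, 1:] ^ Suc n) (\<lambda>j. \<phi> j i + u i * g j)"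
        by (simp only:)
      also have "\<dots> = (\<lambda>j. 0)"
        unfolding shift_poly_add_right shift_poly_scale_right g0 \<phi>0 by simp
      finally show ?thesis .
    qed
  qed
  then have "shift_poly_seq ([:-z, 1:] ^ Suc n) \<psi> = 0"
    by (simp add: shift_poly_seq_def fun_eq_iff del: power_Suc)
  moreover have "\<psi> \<in> seq_space d" by (simp add: seq_space_def \<psi>_def)
  ultimately have "\<psi> \<in> gen_eigenspace d z"
    unfolding gen_eigenspace_def by blast
  moreover have "mat_shift d (root_factor d k z u) \<psi> = \<phi>"
  proof (intro ext)
    fix j i
    show "mat_shift d (root_factor d k z u) \<psi> j i = \<phi> j i"
    proof (cases "i < d")
      case True
      then show ?thesis
        using assms(2) by (simp add: mat_shift_root_factor \<psi>_def g)
    next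
      case False
      then show ?thesis using \<phi> by (simp add: mat_shift_def seq_space_def)
    qed
  qed
  ultimately show ?thesis by blast
qed

text \<open>Induction on the order of vanishing: splitting one factor \<open>root_factor\<close> off the right of
  \<open>M\<close> lowers the order of \<open>det M\<close> by one, and the factor is onto with a one-dimensional kernel.\<close>
lemma gen_eigenspace_kernel_basis:
  assumes "z \<noteq> 0" "M \<in> carrier_mat d d" "det M \<noteq> 0" "order z (det M) = s"
  shows "\<exists>S. finite S \<and> card S = s \<and> seq.independent S \<and>
    seq.span S = {\<psi> \<in> gen_eigenspace d z. mat_shift d M \<psi> = 0}"
  using assms(2-)
proof (induction s arbitrary: M)
  case 0
  have nz: "poly (det M) z \<noteq> 0"
    using 0 by (simp add: order_eq_0_iff)
  \<comment> \<open>Such a \<psi> is annihilated by det M and by a power of T - z, and these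
    polynomials are coprime.\<close>
  have "\<psi> = 0" if \<psi>: "\<psi> \<in> gen_eigenspace d z" "mat_shift d M \<psi> = 0" for \<psi>
  proof -
    obtain n where "\<psi> \<in> seq_space d" "shift_poly_seq ([:-z, 1:] ^ n) \<psi> = 0"
      using \<psi>(1) unfolding gen_eigenspace_def by blast
    with \<psi>(2) show ?thesis
      using coprime_kernels_trivial[OF nz] mat_shift_kernel_det[OF 0(1)] by blast
  qed
  then have "{\<psi> \<in> gen_eigenspace d z. mat_shift d M \<psi> = 0} = {0}"
    using seq.subspace_0[OF subspace_gen_eigenspace] by auto
  then have "seq.span {} = {\<psi> \<in> gen_eigenspace d z. mat_shift d M \<psi> = 0}"
    by (simp only: seq.span_empty)
  then show ?case
    using seq.independent_empty card.empty finite.emptyI by blast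
next
  case (Suc s)
  have "poly (det M) z = 0"
    using Suc.prems by (simp add: order_root)
  from split_root_factor[OF Suc.prems(1) this] obtain B u k where
    k: "k < d" and u: "u k = 1" and B: "B \<in> carrier_mat d d" and M: "M = B * root_factor d k z u"
    by blast
  have det: "det M = det B * [:-z, 1:]"
    unfolding M det_mult[OF B root_factor_carrier] det_root_factor[OF k] ..
  then have detB: "det B \<noteq> 0" using Suc.prems(2) by auto
  have "order z (det M) = order z (det B) + order z [:-z, 1:]"
    unfolding det by (rule order_mult) (use Suc.prems(2) det in simp)
  moreover have "order z [:-z, 1:] = 1"
    using order_power_n_n[of z 1] by simp
  ultimately have "order z (det B) = s" using Suc.prems(3) by simp
  from Suc.IH[OF B detB this] obtain S where
    S: "finite S" "card S = s" "seq.independent S"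
    and span: "seq.span S = {\<psi> \<in> gen_eigenspace d z. mat_shift d B \<psi> = 0}"
    by blast
  define f where "f = mat_shift d (root_factor d k z u)"
  define W where "W = {\<psi> \<in> gen_eigenspace d z. mat_shift d M \<psi> = 0}"
  \<comment> \<open>The sequence \<open>Phi z 1\<close> times the vector \<open>u\<close>, which
    spans the kernel of the split-off factor.\<close>
  define e where "e = (\<lambda>j i. if i < d then u i * Phi z 1 j else 0)"
  have Mf: "mat_shift d M \<psi> = mat_shift d B (f \<psi>)" for \<psi>
    unfolding M f_def by (rule mat_shift_mult[OF B root_factor_carrier])
  have lin: "Vector_Spaces.linear seq_scale seq_scale f"
    by unfold_locales (simp_all only: f_def mat_shift_add mat_shift_scale)
  have subW: "seq.subspace W"
    using subspace_gen_eigenspace[of d z] unfolding W_def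
    by (auto simp: seq.subspace_def mat_shift_add mat_shift_scale)
  have Phi0: "shift_poly [:-z, 1:] (Phi z 1) = (\<lambda>j. 0)"
    using linear_factor_Phi(2)[OF assms(1)] by simp
  have fe: "f e = 0"
  proof (intro ext)
    fix j i
    show "f e j i = 0 j i"
    proof (cases "i < d")
      case True
      then show ?thesis
        using k u Phi0 by (simp add: f_def mat_shift_root_factor e_def)
    qed (simp add: f_def mat_shift_def)
  qed
  have eW: "e \<in> W"
  proof -
    have "shift_poly [:-z, 1:] (\<lambda>j. e j i) = (\<lambda>j. 0)" for i
      using Phi0 by (cases "i < d") (simp_all add: e_def shift_poly_scale_right)
    then have "shift_poly_seq ([:-z, 1:] ^ 1) e = 0"
      by (simp add: shift_poly_seq_def fun_eq_iff)
    moreover have "e \<in> seq_space d" by (simp add: e_def seq_space_def)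
    moreover have "mat_shift d M e = 0" by (simp only: Mf fe mat_shift_zero)
    ultimately show ?thesis
      unfolding W_def gen_eigenspace_def by blast
  qed
  have "e 0 k = 1" using k u by (simp add: e_def Phi_1)
  then have e0: "e \<noteq> 0" by (metis zero_fun_apply zero_neq_one)
  \<comment> \<open>Row \<open>k\<close> is the first-order equation for component \<open>k\<close>,
    whose solutions are multiples of \<open>Phi z 1\<close>; the other rows make component
    \<open>i\<close> equal to \<open>u i\<close> times component \<open>k\<close>.\<close>
  have ker: "\<exists>c. \<psi> = seq_scale c e" if \<psi>: "\<psi> \<in> W" "f \<psi> = 0" for \<psi>
  proof -
    have eq: "f \<psi> j i = 0" for j i using \<psi>(2) by simp
    have "shift_poly [:-z, 1:] (\<lambda>j. \<psi> j k) = (\<lambda>j. 0)"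
      using eq[of _ k] k by (simp add: f_def mat_shift_root_factor fun_eq_iff)
    from linear_factor_kernel[OF assms(1) this]
    have \<psi>k: "\<psi> j k = \<psi> 0 k * Phi z 1 j" for j by meson
    have \<psi>i: "\<psi> j i = u i * \<psi> j k" if "i < d" for i j
      using eq[of j i] that k u by (cases "i = k") (simp_all add: f_def mat_shift_root_factor)
    have "\<psi> j i = seq_scale (\<psi> 0 k) e j i" for j i
    proof (cases "i < d")
      case True
      then show ?thesis
        unfolding \<psi>i[OF True] \<psi>k[of j] by (simp add: seq_scale_def e_def)
    next
      case False
      then show ?thesis
        using \<psi>(1) by (simp add: W_def gen_eigenspace_def seq_space_def seq_scale_def e_def)
    qed
    then show ?thesis by blast
  qed
  have img: "f ` W = seq.span S"
  proof (intro equalityI subsetI)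
    fix \<phi> assume "\<phi> \<in> f ` W"
    then show "\<phi> \<in> seq.span S"
      unfolding span W_def using Mf by (auto simp: f_def mat_shift_gen_eigenspace)
  next
    fix \<phi> assume \<phi>: "\<phi> \<in> seq.span S"
    then obtain \<psi> where "\<psi> \<in> gen_eigenspace d z" "f \<psi> = \<phi>"
      unfolding span f_def using root_factor_surj[OF assms(1) k] by blast
    with \<phi> show "\<phi> \<in> f ` W"
      unfolding span W_def using Mf by auto
  qed
  from seq.basis_of_preimage[OF lin subW S(1,3) eW e0 fe ker img] show ?case
    unfolding W_def S(2) .
qed

text \<open>On the kernel of M(T) the exponent can be taken to be the order: the cofactor of that
  power of w - z in det M does not vanish at z, hence acts injectively on sequences annihilated by a
  power of T - z.\<close>

lemma gen_eigenspace_kernel_eq: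
  assumes "z \<noteq> 0" "M \<in> carrier_mat d d" "det M \<noteq> 0"
  shows "{\<psi> \<in> gen_eigenspace d z. mat_shift d M \<psi> = 0} =
    {\<psi> \<in> seq_space d. mat_shift d M \<psi> = 0} \<inter> T_space d z (order z (det M))"
proof (intro equalityI subsetI)
  fix \<psi> assume "\<psi> \<in> {\<psi> \<in> gen_eigenspace d z. mat_shift d M \<psi> = 0}"
  then obtain n where \<psi>: "\<psi> \<in> seq_space d" "mat_shift d M \<psi> = 0" "shift_poly_seq ([:-z, 1:] ^ n) \<psi> = 0"
    by (auto simp: gen_eigenspace_def)
  from order_decomp[OF assms(3)] obtain q where
    q: "det M = [:-z, 1:] ^ order z (det M) * q" "\<not> [:-z, 1:] dvd q" by blast
  have "shift_poly_seq q (shift_poly_seq ([:-z, 1:] ^ order z (det M)) \<psi>) = 0"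
    using mat_shift_kernel_det[OF assms(2) \<psi>(1,2)]
    by (simp only: shift_poly_seq_mult[symmetric] mult.commute[of q] q(1)[symmetric])
  moreover have "shift_poly_seq ([:-z, 1:] ^ n) (shift_poly_seq ([:-z, 1:] ^ order z (det M)) \<psi>) = 0"
    using shift_poly_seq_dvd[OF _ \<psi>(3)] by (simp only: shift_poly_seq_mult[symmetric]) simp
  ultimately have "shift_poly_seq ([:-z, 1:] ^ order z (det M)) \<psi> = 0"
    using coprime_kernels_trivial q(2) by (simp add: poly_eq_0_iff_dvd)
  with \<psi> show "\<psi> \<in> {\<psi> \<in> seq_space d. mat_shift d M \<psi> = 0} \<inter> T_space d z (order z (det M))"
    by (simp add: T_space_eq_kernel[OF assms(1)])
next
  fix \<psi> assume "\<psi> \<in> {\<psi> \<in> seq_space d. mat_shift d M \<psi> = 0} \<inter> T_space d z (order z (det M))"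
  then show "\<psi> \<in> {\<psi> \<in> gen_eigenspace d z. mat_shift d M \<psi> = 0}"
    by (auto simp: T_space_eq_kernel[OF assms(1)] gen_eigenspace_def)
qed

section \<open>Matrix kernels and the theorem\<close>

text \<open>Linearity of \<open>T_embed\<close>, linking the vector space structure on
  \<open>mat_kernel A\<close> with the one on sequences.\<close>

lemma T_embed_lincomb:
  assumes A: "A \<in> carrier_mat nr (d * s)" and B: "B \<subseteq> mat_kernel A"
  shows "T_embed d z s (module.lincomb (module_vec TYPE(complex) (d * s)\<lparr>carrier := mat_kernel A\<rparr>) c B) =
    (\<Sum>b\<in>B. seq_scale (c b) (T_embed d z s b))"
proof (intro ext)
  fix j m
  interpret kernel nr "d * s" A by unfold_locales (rule A)
  have "T_embed d z s (lincomb c B) j m = (\<Sum>b\<in>B. seq_scale (c b) (T_embed d z s b)) j m"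
  proof (cases "m < d")
    case True
    have "T_embed d z s (lincomb c B) j m =
        (\<Sum>v\<in>{1..s}. Phi z v j * lincomb c B $ ((v - 1) * d + m))"
      using True by (simp add: T_embed_def)
    also have "\<dots> = (\<Sum>v\<in>{1..s}. \<Sum>b\<in>B. c b * (Phi z v j * b $ ((v - 1) * d + m)))"
      using block_index_less[OF _ True, of _ s]
      by (intro sum.cong refl) (simp add: lincomb_index[OF _ B] sum_distrib_left mult_ac)
    also have "\<dots> = (\<Sum>b\<in>B. \<Sum>v\<in>{1..s}. c b * (Phi z v j * b $ ((v - 1) * d + m)))"
      by (rule sum.swap)
    also have "\<dots> = (\<Sum>b\<in>B. seq_scale (c b) (T_embed d z s b)) j m"
      using True by (simp add: sum_seq_apply seq_scale_def T_embed_def sum_distrib_left)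
    finally show ?thesis .
  qed (simp add: sum_seq_apply seq_scale_def T_embed_def)
  then show "T_embed d z s (module.lincomb VK c B) j m =
      (\<Sum>b\<in>B. seq_scale (c b) (T_embed d z s b)) j m" .
qed

text \<open>Injectivity and linearity of \<open>T_embed\<close> carry a basis of a matrix kernel to
  a basis of its image, so \<open>kernel_dim\<close> can be compared with dimensions of sequence
  spaces.\<close>

lemma T_embed_kernel_basis:
  assumes A: "A \<in> carrier_mat nr (d * s)" and B: "kernel.basis (d * s) A B"
  shows "card (T_embed d z s ` B) = kernel_dim A"
    "seq.independent (T_embed d z s ` B)"
    "seq.span (T_embed d z s ` B) = T_embed d z s ` mat_kernel A"
proof -
  interpret kernel nr "d * s" A by unfold_locales (rule A)
  have li: "lin_indpt B" and gen: "span B = mat_kernel A" and sub: "B \<subseteq> mat_kernel A"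
    using B by (auto simp: Ker.basis_def)
  \<comment> \<open>Finiteness of \<open>B\<close> is drawn from that of some basis
    \<open>B'\<close>.\<close>
  obtain B' where "finite B'" "basis B'"
    using kernel_basis_exists[OF A] by blast
  then have "Ker.fin_dim"
    by (auto simp: Ker.fin_dim_def Ker.basis_def)
  then have fin: "finite B"
    using li sub by (rule Ker.fin_dim_li_fin)
  have carrier: "mat_kernel A \<subseteq> carrier_vec (d * s)"
    using mat_kernel_carrier[OF A] .
  have inj: "inj_on (T_embed d z s) (mat_kernel A)"
    using T_embed_inj_on carrier by (rule inj_on_subset)
  then have injB: "inj_on (T_embed d z s) B"
    using sub by (rule inj_on_subset)
  show "card (T_embed d z s ` B) = kernel_dim A"
    using Ker.dim_basis[OF fin B] by (simp add: card_image[OF injB])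
  have comb: "T_embed d z s (lincomb c B) = (\<Sum>b\<in>B. seq_scale (c b) (T_embed d z s b))" for c
    by (rule T_embed_lincomb[OF A sub])
  have lc: "lincomb c B \<in> mat_kernel A" for c
    using Ker.lincomb_closed[OF sub] by auto
  have zero: "0\<^sub>v (d * s) \<in> mat_kernel A"
    using A by (intro mat_kernelI[OF A]) auto
  show "seq.independent (T_embed d z s ` B)"
  proof (rule seq.independent_if_scalars_zero)
    show "finite (T_embed d z s ` B)" using fin by simp
    fix g x assume g: "(\<Sum>x\<in>T_embed d z s ` B. seq_scale (g x) x) = 0" and x: "x \<in> T_embed d z s ` B"
    then obtain b where b: "b \<in> B" "x = T_embed d z s b" by blast
    have "T_embed d z s (lincomb (\<lambda>b. g (T_embed d z s b)) B) = T_embed d z s (0\<^sub>v (d * s))"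
      unfolding comb T_embed_zero using g by (simp only: sum.reindex[OF injB] o_def)
    then have "lincomb (\<lambda>b. g (T_embed d z s b)) B = 0\<^sub>v (d * s)"
      using inj_onD[OF inj _ lc zero] by blast
    then show "g x = 0"
      using Ker.lin_dep_crit[OF fin order_refl, of "\<lambda>b. g (T_embed d z s b)" b] li b by auto
  qed
  show "seq.span (T_embed d z s ` B) = T_embed d z s ` mat_kernel A"
  proof (intro equalityI subsetI)
    fix x assume "x \<in> seq.span (T_embed d z s ` B)"
    then obtain g where "x = (\<Sum>y\<in>T_embed d z s ` B. seq_scale (g y) y)"
      using seq.span_finite[of "T_embed d z s ` B"] fin by auto
    then have "x = T_embed d z s (lincomb (\<lambda>b. g (T_embed d z s b)) B)"
      unfolding comb by (simp only: sum.reindex[OF injB] o_def)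
    with lc show "x \<in> T_embed d z s ` mat_kernel A" by blast
  next
    fix x assume "x \<in> T_embed d z s ` mat_kernel A"
    then obtain v where v: "v \<in> mat_kernel A" "x = T_embed d z s v" by blast
    then obtain c where "lincomb c B = v"
      using Ker.finite_in_span[OF fin sub, of v] gen by auto
    then have "x = (\<Sum>b\<in>B. seq_scale (c b) (T_embed d z s b))"
      using v comb by metis
    also have "\<dots> \<in> seq.span (T_embed d z s ` B)"
      by (intro seq.span_sum seq.span_scale seq.span_base imageI)
    finally show "x \<in> seq.span (T_embed d z s ` B)" .
  qed
qed

text \<open>Lets A(z) be treated as a block matrix with a single block, so that the results on
  \<open>T_embed\<close> cover it.\<close>

lemma symbol_eval_eq_block_symbol: "symbol_eval d a p q z = block_symbol d a p q 1 z"
  by (rule eq_matI) (auto simp: symbol_deriv_def block_symbol_def)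

lemma Phi_vec_eq_T_embed: "Phi_vec d z 1 = T_embed d z 1"
  by (auto simp: fun_eq_iff Phi_vec_def T_embed_def)

lemma T_space_mono:
  assumes "z \<noteq> 0" "s \<le> t"
  shows "T_space d z s \<subseteq> T_space d z t"
  unfolding T_space_eq_kernel[OF assms(1)]
  using shift_poly_seq_dvd[OF le_imp_power_dvd[OF assms(2)]] by blast

text \<open>An element of \<open>S\<close> outside \<open>span C\<close> would enlarge
  \<open>C\<close> to an independent subset of \<open>span S\<close> with more elements than
  \<open>S\<close>.\<close>

lemma (in vector_space) span_eq_of_card_eq:
  assumes "finite S" "independent C" "C \<subseteq> span S" "card C = card S"
  shows "span C = span S"
proof
  show "span C \<subseteq> span S"
    using assms(3) by (intro span_minimal) auto
  have C: "finite C" using independent_span_bound[OF assms(1-3)] by simp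
  have "x \<in> span C" if "x \<in> S" for x
  proof (rule ccontr)
    assume x: "x \<notin> span C"
    then have "independent (insert x C)"
      using assms(2) by (rule independent_insertI)
    moreover have "insert x C \<subseteq> span S"
      using that assms(3) by (auto intro: span_base)
    ultimately have "card (insert x C) \<le> card S"
      using independent_span_bound[OF assms(1)] by blast
    moreover have "x \<notin> C" using x span_base by blast
    ultimately show False using C assms(4) by simp
  qed
  then show "span S \<subseteq> span C" by (intro span_minimal) auto
qed

theorem mainTheorem8:
  fixes d :: nat and a :: "int \<Rightarrow> complex mat" and p q :: int
  defines "P \<equiv> det (symbol_poly_mat d a p q)"
  defines "Z \<equiv> {z :: complex. z \<noteq> 0 \<and> poly P z = 0}"
  defines "K \<equiv> bbl_kernel d a p q"
  assumes d: "1 \<le> d"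
    and bw: "laurent_bw d a p q"
    and reg: "regular_bbl d a p q"
  shows "internal_direct_sum K Z (\<lambda>z. K \<inter> T_space d z (order z P))
    \<and> (\<forall>z\<in>Z. bij_betw (T_embed d z (order z P)) (carrier_vec (d * order z P)) (T_space d z (order z P))
         \<and> T_embed d z (order z P) ` mat_kernel (block_symbol d a p q (order z P) z)
             = K \<inter> T_space d z (order z P))
    \<and> (\<exists>B. finite B \<and> B \<subseteq> K \<and> seq_span B = K)
    \<and> (\<forall>z\<in>Z. kernel_dim (symbol_eval d a p q z) \<le> kernel_dim (block_symbol d a p q (order z P) z)
         \<and> kernel_dim (block_symbol d a p q (order z P) z) = order z P)
    \<and> (\<forall>z\<in>Z. kernel_dim (symbol_eval d a p q z) = order z P \<longrightarrow>
         (\<forall>B. kernel.basis d (symbol_eval d a p q z) B \<longrightarrow>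
            K \<inter> T_space d z (order z P) = seq_span ((Phi_vec d z 1) ` B)))"
proof -
  define M where "M = symbol_poly_mat d a p q"
  have M: "M \<in> carrier_mat d d"
    unfolding M_def by (rule symbol_poly_mat_carrier)
  have P: "P = det M" "P \<noteq> 0"
    using reg by (simp_all add: P_def M_def regular_bbl_def)
  have K: "K = {\<psi> \<in> seq_space d. mat_shift d M \<psi> = 0}"
    unfolding K_def M_def by (rule bbl_kernel_eq_mat_shift_kernel)
  have nz: "z \<noteq> 0" if "z \<in> Z" for z
    using that by (simp add: Z_def)
  have finZ: "finite Z"
    using poly_roots_finite[OF P(2)] by (rule rev_finite_subset) (auto simp: Z_def)
  have ds: "internal_direct_sum K Z (\<lambda>z. K \<inter> T_space d z (order z P))"
    unfolding P(1) by (rule kernel_direct_sum[OF M]) (use P in \<open>auto simp: K Z_def\<close>)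
  have ker: "T_embed d z s ` mat_kernel (block_symbol d a p q s z) = K \<inter> T_space d z s"
    if "z \<in> Z" for z s
    unfolding K_def using nz[OF that] by (rule T_embed_mat_kernel)
  have "\<exists>S. finite S \<and> card S = order z P \<and> seq.independent S \<and>
      seq.span S = K \<inter> T_space d z (order z P)" if "z \<in> Z" for z
    using gen_eigenspace_kernel_basis[OF nz[OF that] M P(2)[unfolded P(1)] refl]
    unfolding gen_eigenspace_kernel_eq[OF nz[OF that] M P(2)[unfolded P(1)]] K P(1) .
  then have "\<forall>z\<in>Z. \<exists>S. finite S \<and> card S = order z P \<and> seq.independent S \<and>
      seq.span S = K \<inter> T_space d z (order z P)" by blast
  from bchoice[OF this] obtain S where
    S: "\<And>z. z \<in> Z \<Longrightarrow> finite (S z)" "\<And>z. z \<in> Z \<Longrightarrow> card (S z) = order z P"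
    "\<And>z. z \<in> Z \<Longrightarrow> seq.independent (S z)"
    "\<And>z. z \<in> Z \<Longrightarrow> seq.span (S z) = K \<inter> T_space d z (order z P)"
    by blast
  \<comment> \<open>By the direct sum, bases of the finitely many summands together span the
    kernel.\<close>
  have findim: "finite (\<Union>z\<in>Z. S z)" "(\<Union>z\<in>Z. S z) \<subseteq> K" "seq.span (\<Union>z\<in>Z. S z) = K"
  proof -
    show "finite (\<Union>z\<in>Z. S z)" using finZ S(1) by blast
    show sub: "(\<Union>z\<in>Z. S z) \<subseteq> K" using S(4) seq.span_superset by blast
    show "seq.span (\<Union>z\<in>Z. S z) = K"
    proof
      show "seq.span (\<Union>z\<in>Z. S z) \<subseteq> K"
        using sub unfolding K_def by (rule seq.span_minimal) (rule subspace_bbl_kernel)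
      show "K \<subseteq> seq.span (\<Union>z\<in>Z. S z)"
      proof
        fix \<psi> assume "\<psi> \<in> K"
        then obtain f where f: "\<psi> = (\<Sum>z\<in>Z. f z)" "\<forall>z\<in>Z. f z \<in> K \<inter> T_space d z (order z P)"
          using ds unfolding internal_direct_sum_def by blast
        have "f z \<in> seq.span (\<Union>z\<in>Z. S z)" if "z \<in> Z" for z
          using f(2) S(4)[OF that] seq.span_mono[of "S z" "\<Union>z\<in>Z. S z"] that by blast
        then show "\<psi> \<in> seq.span (\<Union>z\<in>Z. S z)"
          unfolding f(1) by (rule seq.span_sum)
      qed
    qed
  qed
  \<comment> \<open>Two bases of the same space are counted: the embedded basis of the matrix kernel
    and \<open>S z\<close>.\<close>
  have dim_block: "kernel_dim (block_symbol d a p q (order z P) z) = order z P" if z: "z \<in> Z" for z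
  proof -
    obtain B where "kernel.basis (d * order z P) (block_symbol d a p q (order z P) z) B"
      using kernel_basis_exists[OF block_symbol_carrier] by blast
    note B = T_embed_kernel_basis[OF block_symbol_carrier this, where z = z]
    have "kernel_dim (block_symbol d a p q (order z P) z) = seq.dim (K \<inter> T_space d z (order z P))"
      using seq.dim_span_eq_card_independent[OF B(2)] unfolding B(3) B(1) ker[OF z] by simp
    also have "\<dots> = order z P"
      using seq.dim_span_eq_card_independent[OF S(3)[OF z]] by (simp add: S(2,4)[OF z])
    finally show ?thesis .
  qed
  \<comment> \<open>The kernel of A(z) embeds onto \<open>K \<inter> T_space d z 1\<close>, which
    lies in the summand at \<open>z\<close> because a root has order at least 1.\<close>
  have eval: "seq.independent (T_embed d z 1 ` B)"
    "card (T_embed d z 1 ` B) = kernel_dim (symbol_eval d a p q z)"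
    "T_embed d z 1 ` B \<subseteq> seq.span (S z)"
    if z: "z \<in> Z" and B: "kernel.basis d (symbol_eval d a p q z) B" for z B
  proof -
    have "kernel.basis (d * 1) (block_symbol d a p q 1 z) B"
      using B unfolding symbol_eval_eq_block_symbol by simp
    note B = T_embed_kernel_basis[OF block_symbol_carrier this, where z = z]
    show "seq.independent (T_embed d z 1 ` B)"
      "card (T_embed d z 1 ` B) = kernel_dim (symbol_eval d a p q z)"
      unfolding symbol_eval_eq_block_symbol by (rule B(2), rule B(1))
    have "order z P \<ge> 1"
      using z P(2) by (simp add: Z_def order_root Suc_le_eq)
    then have "T_space d z 1 \<subseteq> T_space d z (order z P)"
      by (rule T_space_mono[OF nz[OF z]])
    then show "T_embed d z 1 ` B \<subseteq> seq.span (S z)"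
      using seq.span_superset[of "T_embed d z 1 ` B"]
      unfolding B(3) ker[OF z] S(4)[OF z] by blast
  qed
  have dim_eval: "kernel_dim (symbol_eval d a p q z) \<le> order z P" if z: "z \<in> Z" for z
  proof -
    have "symbol_eval d a p q z \<in> carrier_mat d d" by (simp add: symbol_deriv_def)
    from kernel_basis_exists[OF this] obtain B where "kernel.basis d (symbol_eval d a p q z) B"
      by blast
    note B = eval[OF z this]
    from seq.independent_span_bound[OF S(1)[OF z] B(1,3)] show ?thesis
      by (simp only: B(2) S(2)[OF z])
  qed
  \<comment> \<open>When the dimensions agree, the embedded basis is an independent subset of
    \<open>seq.span (S z)\<close> with as many elements as \<open>S z\<close>, so it spans the same
    space.\<close>
  have span_eval: "K \<inter> T_space d z (order z P) = seq.span (Phi_vec d z 1 ` B)"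
    if z: "z \<in> Z" and dim: "kernel_dim (symbol_eval d a p q z) = order z P"
      and B: "kernel.basis d (symbol_eval d a p q z) B" for z B
    using seq.span_eq_of_card_eq[OF S(1)[OF z] eval(1,3)[OF z B]] eval(2)[OF z B] dim
    unfolding Phi_vec_eq_T_embed S(2,4)[OF z] by argo
  show ?thesis
    using ds T_embed_bij_betw[OF nz] ker findim dim_block dim_eval span_eval
    by (intro conjI ballI allI impI exI[of _ "\<Union>z\<in>Z. S z"]) (auto simp only:)
qed

end
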